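(* For every $\varepsilon>0$ there exist $\delta,\eta>0$ and constants $C>0$, $p_0$ (all depending only on $\varepsilon$) such that for every prime $p\ge p_0$, every set $\mathcal{M}\subseteq\mathbb{F}_p$ of cardinality $M>p^{\varepsilon}$, every interval $\mathcal{J}\subseteq\mathbb{F}_p^*$ of length $N>p^{1/2-\delta}$, and arbitrary complex weights $\boldsymbol\alpha=\{\alpha_m\}_{m\in\mathcal{M}}$, $$\Bigl|\sum_{m\in\mathcal{M}}\sum_{n\in\mathcal{J}}\alpha_m\,\mathcal{K}_p(m,n)\Bigr|\le C\,\|\boldsymbol\alpha\|_\infty\,MN\,p^{1/2-\eta}.$$
   Context: $\mathbf{e}_p(z)=\exp(2\pi i z/p)$, and the Kloosterman sum is $\mathcal{K}_p(m,n)=\sum_{x\in\mathbb{F}_p^*}\mathbf{e}_p(mx+nx^{-1})$, with $x^{-1}$ the inverse of $x$ in $\mathbb{F}_p^*$. $\mathbb{F}_p$ is identified with $\{0,1,\dots,p-1\}$; an interval in $\mathbb{F}_p$ of length $N$ is the set of residues modulo $p$ of $N$ consecutive integers $N_0+1,\dots,N_0+N$. $\|\boldsymbol\alpha\|_\infty=\max_m|\alpha_m|$. *)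

theory Defs
  imports "HOL-Analysis.Analysis" "HOL-Number_Theory.Modular_Inverse"
begin

text \<open>The field of \<open>p\<close> elements is represented by the set of residues \<open>{0..<p}\<close>
  inside the integers, with arithmetic modulo \<open>p\<close>.\<close>

definition Fp :: "nat \<Rightarrow> int set" where
  "Fp p = {0..<int p}"

definition Fp_star :: "nat \<Rightarrow> int set" where
  "Fp_star p = Fp p - {0}"

definition e_p :: "nat \<Rightarrow> complex \<Rightarrow> complex" where
  "e_p p z = exp (2 * of_real pi * \<i> * z / of_nat p)"

definition kloosterman :: "nat \<Rightarrow> int \<Rightarrow> int \<Rightarrow> complex" where
  "kloosterman p m n =
     (\<Sum>x\<in>Fp_star p. e_p p (of_int (m * x + n * modular_inverse (int p) x)))"

text \<open>The \<open>N\<close> consecutive integers are reduced modulo \<open>p\<close>, so an interval may wrap around.\<close>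

definition Fp_interval :: "nat \<Rightarrow> nat \<Rightarrow> int set \<Rightarrow> bool" where
  "Fp_interval p N J \<longleftrightarrow> (\<exists>N0::int. J = (\<lambda>k. k mod int p) ` {N0 + 1..N0 + int N})"

text \<open>Only used for a finite nonempty index set; the values of the weights outside it are
  irrelevant.\<close>

definition weight_sup_norm :: "int set \<Rightarrow> (int \<Rightarrow> complex) \<Rightarrow> real" where
  "weight_sup_norm S \<alpha> = Max ((\<lambda>m. cmod (\<alpha> m)) ` S)"

end

theory Submission
  imports Defs "HOL-Number_Theory.Residues"
begin

text \<open>Opening the Kloosterman sums turns the bilinear sum into \<open>\<Sum>y. A(1/y) F(y)\<close>, where
  \<open>A(x) = \<Sum>m. \<alpha>\<^sub>m e(mx)\<close> and \<open>F\<close> is the exponential sum over the interval, so that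
  \<open>|F(y)| \<le> min(N, p/|y|)\<close>. By partial summation it is enough to save a power of \<open>p\<close>, depending
  only on \<open>\<epsilon>\<close>, in \<open>\<Sum>y\<le>Y. |A(1/y)|\<close> for all \<open>Y \<ge> \<surd>p\<close>. By Cauchy-Schwarz this reduces to
  incomplete Kloosterman sums \<open>K(a) = \<Sum>y\<le>Y. e(a/y)\<close>, averaged over \<open>a\<close> in a translate of the set.
  The shift \<open>y \<mapsto> y + uv\<close> writes \<open>K(a)\<close> as an average of \<open>\<Sum>v. e(s/(r + v))\<close> with
  \<open>s = a/u\<close>, \<open>r = y/u\<close>. Each pair \<open>(s, r)\<close> has few representations of this form, so after Hoelder's
  inequality one may complete the sum to all residues \<open>s, r\<close>. The \<open>2k\<close>-th moment then counts
  solutions of \<open>\<Sum>i\<le>k. 1/(r + v\<^sub>i) = \<Sum>i\<le>k. 1/(r + w\<^sub>i)\<close>; as \<open>r\<close> is free, it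
  is enough to bound the number of roots of a polynomial, and no deep bound for exponential sums is
  needed. A large \<open>k\<close> makes this work as soon as \<open>M > p\<^sup>\<epsilon>\<close>.

  The inverse of \<open>x\<close> modulo \<open>p\<close> is written \<open>x ^ (p - 2)\<close>, which is multiplicative and compatible
  with congruences, and sends multiples of \<open>p\<close> to multiples of \<open>p\<close>.\<close>

section \<open>Additive characters and roots of polynomials modulo a prime\<close>

text \<open>Additive character at integer arguments. Writing it with \<open>cis\<close> makes
  additivity, conjugation and De Moivre's formula directly available.\<close>

definition ep :: "nat \<Rightarrow> int \<Rightarrow> complex" where
  "ep p z = cis (2 * pi * of_int z / of_nat p)"

lemma e_p_of_int: "e_p p (of_int z) = ep p z"
  unfolding e_p_def ep_def cis_conv_exp by (intro arg_cong[where f = exp]) simp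

lemma ep_0 [simp]: "ep p 0 = 1"
  by (simp add: ep_def)

lemma ep_add: "ep p (a + b) = ep p a * ep p b"
  by (simp add: ep_def cis_mult field_simps add_divide_distrib)

lemma ep_minus: "ep p (- a) = cnj (ep p a)"
  by (simp add: ep_def cis_cnj)

lemma norm_ep [simp]: "cmod (ep p a) = 1"
  by (simp add: ep_def)

lemma ep_sum: "finite A \<Longrightarrow> ep p (\<Sum>i\<in>A. f i) = (\<Prod>i\<in>A. ep p (f i))"
  by (induction A rule: finite_induct) (auto simp: ep_add)

lemma ep_power: "ep p (int n * a) = ep p a ^ n"
  unfolding ep_def Complex.DeMoivre by (simp add: algebra_simps)

lemma ep_multiple: "p > 0 \<Longrightarrow> ep p (int p * t) = 1"
proof -
  assume "p > 0"
  then have "2 * pi * of_int (int p * t) / of_nat p = 2 * pi * of_int t"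
    by simp
  then show ?thesis unfolding ep_def by (metis cis_multiple_2pi Ints_of_int)
qed

lemma ep_cong:
  assumes "p > 0" "[a = b] (mod int p)"
  shows "ep p a = ep p b"
proof -
  obtain t where "a = b + int p * t"
    using assms(2) by (metis cong_iff_lin cong_sym)
  then show ?thesis using assms(1) by (simp add: ep_add ep_multiple)
qed

lemma ep_eq_1_iff:
  assumes "p > 0"
  shows "ep p t = 1 \<longleftrightarrow> int p dvd t"
proof
  assume "ep p t = 1"
  then have "cos (2 * pi * of_int t / of_nat p) = 1"
    by (simp add: ep_def complex_eq_iff)
  then obtain n :: int where "2 * pi * of_int t / of_nat p = of_int n * 2 * pi"
    using cos_one_2pi_int by blast
  then have "real_of_int t = of_int (n * int p)"
    using assms by (simp add: field_simps)
  then have "t = n * int p" by linarith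
  then show "int p dvd t" by simp
next
  assume "int p dvd t"
  then show "ep p t = 1" using assms by (auto simp: ep_multiple)
qed

text \<open>A geometric series whose ratio \<open>ep p t\<close> is a \<open>p\<close>-th root of
  unity. In the moment computation it turns a sum over \<open>s\<close> into the detection of a
  congruence.\<close>

lemma ep_orthogonality:
  assumes "p > 0"
  shows "(\<Sum>s\<in>{0..<int p}. ep p (s * t)) = (if int p dvd t then of_nat p else 0)"
proof -
  have "(\<Sum>s\<in>{0..<int p}. ep p (s * t)) = (\<Sum>s<p. ep p t ^ s)"
    by (rule sum.reindex_bij_witness[of _ int nat]) (auto simp: ep_power[symmetric])
  also have "\<dots> = (if int p dvd t then of_nat p else 0)"
  proof (cases "int p dvd t")
    case True
    then show ?thesis using assms by (simp add: ep_eq_1_iff[THEN iffD2])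
  next
    case False
    moreover have "ep p t ^ p = 1"
      using assms by (simp add: ep_power[symmetric] ep_multiple)
    ultimately show ?thesis
      using assms by (simp add: ep_eq_1_iff geometric_sum)
  qed
  finally show ?thesis .
qed

text \<open>Lagrange's bound, by splitting off one root at a time with synthetic division over the
  integers; primality passes every other root to the quotient. Non-triviality modulo
  \<open>p\<close> is expressed by one value prime to \<open>p\<close>, since in the application a
  value is easy to compute while coefficients are not.\<close>

lemma card_poly_roots_mod_prime:
  fixes f :: "int poly"
  assumes "prime p" "\<not> int p dvd poly f x0"
  shows "card {x \<in> {0..<int p}. int p dvd poly f x} \<le> degree f"
  using assms(2)
proof (induction "degree f" arbitrary: f)
  case 0
  then obtain c where f: "f = [:c:]" by (metis degree_eq_zeroE)
  then show ?case using 0 by simp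
next
  case (Suc n)
  let ?R = "\<lambda>f. {x \<in> {0..<int p}. int p dvd poly f x}"
  show ?case
  proof (cases "?R f = {}")
    case False
    then obtain r where r: "r \<in> {0..<int p}" "int p dvd poly f r" by blast
    define g where "g = synthetic_div f r"
    have f: "poly f x = (x - r) * poly g x + poly f r" for x
      using arg_cong[OF synthetic_div_correct'[of r f], of "\<lambda>q. poly q x"]
      by (simp add: g_def algebra_simps)
    have dg: "degree g = n" using Suc by (simp add: g_def degree_synthetic_div)
    \<comment> \<open>If \<open>p\<close> divided \<open>poly g x0\<close>, it would divide
      \<open>(x0 - r) * poly g x0 + poly f r\<close>, which is \<open>poly f x0\<close>. So the same
      witness serves the quotient.\<close>
    have "\<not> int p dvd poly g x0"
      using Suc.prems r(2) f[of x0] by (metis dvd_add dvd_mult)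
    then have n: "card (?R g) \<le> n" using Suc dg by blast
    have "?R f \<subseteq> insert r (?R g)"
    proof
      fix x assume x: "x \<in> ?R f"
      then have "int p dvd (x - r) * poly g x"
        using f[of x] r(2) by (simp add: dvd_add_left_iff)
      then have "int p dvd x - r \<or> int p dvd poly g x"
        using assms(1) by (simp add: prime_dvd_mult_iff)
      moreover have "x = r" if "int p dvd x - r"
      proof -
        have "[x = r] (mod int p)" using that by (simp add: cong_iff_dvd_diff)
        then show ?thesis using x r by (simp add: cong_def)
      qed
      ultimately show "x \<in> insert r (?R g)" using x by auto
    qed
    then have "card (?R f) \<le> card (insert r (?R g))"
      by (intro card_mono finite_subset[of "insert r (?R g)" "insert r {0..<int p}"]) auto
    also have "\<dots> \<le> Suc (card (?R g))"
      using card_Un_le[of "{r}" "?R g"] by simp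
    finally have "card (?R f) \<le> Suc n"
      using n by linarith
    then show ?thesis using Suc by simp
  next
    case True
    then show ?thesis by (simp only: card.empty)
  qed
qed

section \<open>Moments of short sums over reciprocals\<close>

lemma prime_fermat_inverse:
  assumes "prime p" "p > 2" "\<not> int p dvd x"
  shows "[x * x ^ (p - 2) = 1] (mod int p)"
proof -
  define a where "a = nat (x mod int p)"
  have "int a = x mod int p" using assms(2) by (simp add: a_def)
  then have a: "[int a = x] (mod int p)" by (simp add: cong_def)
  then have "\<not> p dvd a"
    using assms(3) by (metis cong_dvd_iff int_dvd_int_iff cong_sym)
  then have "[int a ^ (p - 1) = 1] (mod int p)"
    using fermat_theorem[OF assms(1)] cong_int_iff[of "a ^ (p - 1)" 1 p] by simp
  then have "[x ^ (p - 1) = 1] (mod int p)"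
    using cong_pow[OF a] by (meson cong_sym cong_trans)
  moreover have "x * x ^ (p - 2) = x ^ (p - 1)"
    using assms(2) by (metis Suc_diff_Suc Suc_1 Suc_lessD diff_Suc_1 numeral_2_eq_2 power_Suc)
  ultimately show ?thesis by simp
qed

lemma card_dvd_add_le_1:
  assumes "prime p"
  shows "card {r \<in> {0..<int p}. int p dvd r + a} \<le> 1"
proof -
  \<comment> \<open>The value at \<open>1 - a\<close> is 1.\<close>
  have "\<not> int p dvd poly [:a, 1:] (1 - a)" using assms by (simp add: prime_nat_iff)
  from card_poly_roots_mod_prime[OF assms this] show ?thesis by (simp add: add.commute)
qed

text \<open>Multiplying by all denominators leaves a polynomial in \<open>r\<close>, and it does not vanish at
  \<open>- f i\<close> because the value \<open>f i\<close> is taken only once.\<close>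

lemma card_roots_reciprocal_sum:
  fixes f c :: "'i \<Rightarrow> int"
  assumes p: "prime p" "p > 2" and I: "finite I" "i \<in> I" and ci: "\<not> int p dvd c i"
    and sep: "\<And>j. j \<in> I \<Longrightarrow> j \<noteq> i \<Longrightarrow> \<not> int p dvd f j - f i"
  shows "card {r \<in> {0..<int p}. int p dvd (\<Sum>j\<in>I. c j * (r + f j) ^ (p - 2))} \<le> 2 * card I"
proof -
  define Q where "Q = (\<Sum>j\<in>I. Polynomial.smult (c j) (\<Prod>l\<in>I - {j}. [:f l, 1:]))"
  have poly_Q: "poly Q x = (\<Sum>j\<in>I. c j * (\<Prod>l\<in>I - {j}. x + f l))" for x
    by (simp add: Q_def poly_sum poly_prod add.commute)
  have "degree (Polynomial.smult (c j) (\<Prod>l\<in>I - {j}. [:f l, 1:])) \<le> card I" for j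
  proof -
    have "degree (\<Prod>l\<in>I - {j}. [:f l, 1:]) \<le> (\<Sum>l\<in>I - {j}. degree [:f l, 1:])"
      using degree_prod_sum_le[of "I - {j}" "\<lambda>l. [:f l, 1:]"] I(1) by (simp add: o_def)
    also have "\<dots> \<le> card I" using I(1) by (simp add: card_mono)
    finally show ?thesis by (meson degree_smult_le order_trans)
  qed
  then have deg_Q: "degree Q \<le> card I"
    unfolding Q_def by (intro degree_sum_le I(1))
  \<comment> \<open>At \<open>- f i\<close> every summand with \<open>j \<noteq> i\<close> contains
    the zero factor \<open>l = i\<close>, so only the summand of \<open>i\<close> survives.\<close>
  have "(\<Sum>j\<in>I - {i}. c j * (\<Prod>l\<in>I - {j}. - f i + f l)) = 0"
    using I by (intro sum.neutral ballI) (auto intro!: prod_zero)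
  then have "poly Q (- f i) = c i * (\<Prod>l\<in>I - {i}. f l - f i)"
    unfolding poly_Q by (subst sum.remove[OF I]) simp
  moreover have "prime (int p)" using p by simp
  ultimately have "\<not> int p dvd poly Q (- f i)"
    using ci sep I(1) by (auto simp: prime_dvd_mult_iff prime_dvd_prod_iff)
  then have 1: "card {r \<in> {0..<int p}. int p dvd poly Q r} \<le> card I"
    using card_poly_roots_mod_prime[OF p(1)] deg_Q by (meson order_trans)
  \<comment> \<open>Residues at which some denominator vanishes are counted apart, at most one for
    each index: there \<open>x ^ (p - 2)\<close> is no inverse and denominators cannot be
    cleared.\<close>
  have "card (\<Union>j\<in>I. {r \<in> {0..<int p}. int p dvd r + f j}) \<le>
      (\<Sum>j\<in>I. card {r \<in> {0..<int p}. int p dvd r + f j})"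
    by (rule card_UN_le[OF I(1)])
  also have "\<dots> \<le> (\<Sum>j\<in>I. 1)"
    by (intro sum_mono card_dvd_add_le_1 p(1))
  finally have 2: "card (\<Union>j\<in>I. {r \<in> {0..<int p}. int p dvd r + f j}) \<le> card I" by simp
  have "{r \<in> {0..<int p}. int p dvd (\<Sum>j\<in>I. c j * (r + f j) ^ (p - 2))} \<subseteq>
      {r \<in> {0..<int p}. int p dvd poly Q r} \<union> (\<Union>j\<in>I. {r \<in> {0..<int p}. int p dvd r + f j})"
    (is "?L \<subseteq> ?R1 \<union> ?R2")
  proof (rule subsetI, rule UnCI)
    fix r assume "r \<in> ?L" "r \<notin> ?R2"
    then have r: "int p dvd (\<Sum>j\<in>I. c j * (r + f j) ^ (p - 2))"
      "r \<in> {0..<int p}" "r \<notin> ?R2" by auto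
    define P where "P = (\<Prod>l\<in>I. r + f l)"
    have "[P * (\<Sum>j\<in>I. c j * (r + f j) ^ (p - 2)) = poly Q r] (mod int p)"
      unfolding poly_Q sum_distrib_left
    proof (rule cong_sum)
      fix j assume j: "j \<in> I"
      have "P * (c j * (r + f j) ^ (p - 2)) =
          c j * (\<Prod>l\<in>I - {j}. r + f l) * ((r + f j) * (r + f j) ^ (p - 2))"
        unfolding P_def by (subst prod.remove[OF I(1) j]) (simp only: mult_ac)
      also have "[\<dots> = c j * (\<Prod>l\<in>I - {j}. r + f l) * 1] (mod int p)"
        using r(2,3) j by (intro cong_mult cong_refl prime_fermat_inverse p) auto
      finally show "[P * (c j * (r + f j) ^ (p - 2)) = c j * (\<Prod>l\<in>I - {j}. r + f l)] (mod int p)"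
        by simp
    qed
    then have "int p dvd poly Q r"
      using r(1) by (metis cong_dvd_iff dvd_mult)
    then show "r \<in> ?R1" using r(2) by simp
  qed
  then have "card {r \<in> {0..<int p}. int p dvd (\<Sum>j\<in>I. c j * (r + f j) ^ (p - 2))} \<le>
      card ({r \<in> {0..<int p}. int p dvd poly Q r} \<union> (\<Union>j\<in>I. {r \<in> {0..<int p}. int p dvd r + f j}))"
    using I(1) by (intro card_mono finite_UnI finite_UN_I)
      (auto intro: finite_subset[of _ "{0..<int p}"])
  also have "\<dots> \<le> card I + card I"
    using 1 2 by (intro order_trans[OF card_Un_le] add_mono)
  finally show ?thesis by simp
qed

section \<open>Counting maps all of whose values are repeated\<close>

lemma card_image_if_all_repeated:
  assumes "finite I" "\<And>i. i \<in> I \<Longrightarrow> \<exists>j\<in>I. j \<noteq> i \<and> f j = f i"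
  shows "2 * card (f ` I) \<le> card I"
proof -
  have "2 * card (f ` I) = (\<Sum>y\<in>f ` I. 2)" by simp
  also have "\<dots> \<le> (\<Sum>y\<in>f ` I. card {x \<in> I. f x = y})"
  proof (rule sum_mono)
    fix y assume "y \<in> f ` I"
    then obtain i j where ij: "i \<in> I" "j \<in> I" "j \<noteq> i" "f i = y" "f j = y"
      using assms(2) by (metis imageE)
    then have "card {i, j} \<le> card {x \<in> I. f x = y}"
      using assms(1) by (intro card_mono) auto
    then show "2 \<le> card {x \<in> I. f x = y}" using ij by simp
  qed
  also have "\<dots> = (\<Sum>y\<in>f ` I. \<Sum>x\<in>{x \<in> I. f x = y}. 1)" by simp
  also have "\<dots> = card I"
    using assms(1) sum.group[of I "f ` I" f "\<lambda>_. 1::nat"] by simp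
  finally show ?thesis .
qed

text \<open>Such a map has at most \<open>k\<close> values, since every fibre has at least two
  elements. Hence it factors through \<open>{..<k}\<close>: there are \<open>card A ^ k\<close>
  choices for the list of values and \<open>k ^ (2 * k)\<close> choices for the positions.\<close>

lemma card_all_repeated_le:
  fixes A :: "'a set"
  assumes A: "finite A" "A \<noteq> {}" and I: "finite I" "card I = 2 * k"
  shows "card {f \<in> I \<rightarrow>\<^sub>E A. \<forall>i\<in>I. \<exists>j\<in>I. j \<noteq> i \<and> f j = f i} \<le> card A ^ k * k ^ (2 * k)"
proof -
  define D where "D = {f \<in> I \<rightarrow>\<^sub>E A. \<forall>i\<in>I. \<exists>j\<in>I. j \<noteq> i \<and> f j = f i}"
  define X where "X = ({..<k} \<rightarrow>\<^sub>E A) \<times> (I \<rightarrow>\<^sub>E {..<k})"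
  have fin: "finite X" using A I by (auto simp: X_def intro!: finite_PiE)
  have "D \<subseteq> (\<lambda>(h, g). \<lambda>i\<in>I. h (g i)) ` X"
  proof
    fix f assume f: "f \<in> D"
    then have "2 * card (f ` I) \<le> card I"
      by (intro card_image_if_all_repeated I) (auto simp: D_def)
    then have le: "card (f ` I) \<le> k" using I by simp
    obtain e where e: "bij_betw e {0..<card (f ` I)} (f ` I)"
      using I(1) ex_bij_betw_nat_finite by blast
    obtain a where a: "a \<in> A" using A by blast
    \<comment> \<open>The list of values of \<open>f\<close>, padded with the arbitrary element
      \<open>a\<close> up to length \<open>k\<close>.\<close>
    define h where "h = (\<lambda>i\<in>{..<k}. if i < card (f ` I) then e i else a)"
    have fA: "f i \<in> A" if "i \<in> I" for i using f that by (auto simp: D_def)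
    have hA: "h \<in> {..<k} \<rightarrow>\<^sub>E A"
    proof -
      have "e j \<in> A" if "j < card (f ` I)" for j
      proof -
        have "e j \<in> f ` I" using bij_betwE[OF e] that by simp
        then obtain i where "i \<in> I" "e j = f i" by (rule imageE)
        then show ?thesis by (simp only: fA)
      qed
      then show ?thesis using a unfolding h_def by (intro restrict_PiE_iff[THEN iffD2]) simp
    qed
    have "\<exists>j<k. h j = f i" if "i \<in> I" for i
    proof -
      have "f i \<in> e ` {0..<card (f ` I)}" using e that by (auto simp: bij_betw_def)
      then obtain j where "j < card (f ` I)" "f i = e j" by auto
      then show ?thesis using le by (intro exI[of _ j]) (auto simp: h_def)
    qed
    then obtain g where g: "\<And>i. i \<in> I \<Longrightarrow> g i < k \<and> h (g i) = f i" by metis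
    have "f = (\<lambda>i\<in>I. h ((restrict g I) i))"
      using f g by (auto simp: D_def PiE_def extensional_def fun_eq_iff)
    moreover have "(h, restrict g I) \<in> X" using hA g by (auto simp: X_def)
    ultimately show "f \<in> (\<lambda>(h, g). \<lambda>i\<in>I. h (g i)) ` X"
      by (intro image_eqI[of _ _ "(h, restrict g I)"]) auto
  qed
  then have "card D \<le> card X"
    using fin by (meson card_image_le card_mono finite_imageI order_trans)
  also have "card X = card A ^ k * k ^ (2 * k)"
    using A I by (simp add: X_def card_cartesian_product card_PiE)
  finally show ?thesis by (simp add: D_def)
qed

definition recip_sum :: "nat \<Rightarrow> nat \<Rightarrow> int \<Rightarrow> int \<Rightarrow> complex" where
  "recip_sum p V s r = (\<Sum>v\<in>{1..V}. ep p (s * (r + int v) ^ (p - 2)))"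

text \<open>Expanding the power and summing over \<open>s\<close> gives \<open>p\<close> times the
  number of pairs \<open>(f, r)\<close> for which a signed sum of \<open>2 * k\<close> reciprocals
  vanishes modulo \<open>p\<close>. If some value of \<open>f\<close> occurs only once, at most
  \<open>4 * k\<close> residues \<open>r\<close> qualify. The remaining \<open>f\<close> are few,
  and for them all \<open>p\<close> residues are allowed.\<close>

lemma recip_sum_moment:
  assumes p: "prime p" "p > 2" and V: "1 \<le> V" "V < p"
  shows "(\<Sum>s\<in>{0..<int p}. \<Sum>r\<in>{0..<int p}. cmod (recip_sum p V s r) ^ (2 * k))
    \<le> real p * (real p * real V ^ k * real k ^ (2 * k) + 4 * real k * real V ^ (2 * k))"
proof -
  define F where "F = {0..<int p}"
  define I where "I = {..<2 * k}"
  \<comment> \<open>The first \<open>k\<close> indices stand for factors \<open>recip_sum\<close>,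
    the last \<open>k\<close> for their conjugates, which enter with a minus sign in the
    exponent.\<close>
  define c :: "nat \<Rightarrow> int" where "c i = (if i < k then 1 else - 1)" for i
  define Om where "Om = I \<rightarrow>\<^sub>E {1..V}"
  define rel where "rel f r \<longleftrightarrow> int p dvd (\<Sum>j\<in>I. c j * (r + int (f j)) ^ (p - 2))" for f r
  define D where "D = {f \<in> Om. \<forall>i\<in>I. \<exists>j\<in>I. j \<noteq> i \<and> f j = f i}"
  have fin: "finite Om" unfolding Om_def I_def by (auto intro!: finite_PiE)
  have cardF: "card F = p" by (simp add: F_def)
  have p0: "p > 0" using p by simp
  have expand: "of_real (cmod (recip_sum p V s r) ^ (2 * k)) =
      (\<Sum>f\<in>Om. ep p (s * (\<Sum>j\<in>I. c j * (r + int (f j)) ^ (p - 2))))" for s r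
  proof -
    have "I \<inter> {i. i < k} = {..<k}" "I \<inter> - {i. i < k} = {k..<2 * k}"
      by (auto simp: I_def)
    then have "(\<Prod>i\<in>I. if i < k then recip_sum p V s r else cnj (recip_sum p V s r)) =
        (recip_sum p V s r * cnj (recip_sum p V s r)) ^ k"
      by (subst prod.If_cases) (auto simp: I_def power_mult_distrib)
    also have "\<dots> = of_real (cmod (recip_sum p V s r) ^ (2 * k))"
      by (simp only: complex_norm_square[symmetric] power_mult of_real_power)
    finally have "of_real (cmod (recip_sum p V s r) ^ (2 * k)) =
        (\<Prod>i\<in>I. if i < k then recip_sum p V s r else cnj (recip_sum p V s r))" ..
    also have "\<dots> = (\<Prod>i\<in>I. \<Sum>v\<in>{1..V}. ep p (s * (c i * (r + int v) ^ (p - 2))))"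
      by (intro prod.cong) (auto simp: c_def recip_sum_def ep_minus)
    also have "\<dots> = (\<Sum>f\<in>Om. \<Prod>i\<in>I. ep p (s * (c i * (r + int (f i)) ^ (p - 2))))"
      unfolding Om_def by (rule prod_sum_PiE) (auto simp: I_def)
    finally show ?thesis by (simp add: sum_distrib_left ep_sum I_def)
  qed
  have "complex_of_real (\<Sum>s\<in>F. \<Sum>r\<in>F. cmod (recip_sum p V s r) ^ (2 * k)) =
      (\<Sum>s\<in>F. \<Sum>r\<in>F. \<Sum>f\<in>Om. ep p (s * (\<Sum>j\<in>I. c j * (r + int (f j)) ^ (p - 2))))"
    by (simp only: of_real_sum expand)
  also have "\<dots> = (\<Sum>f\<in>Om. \<Sum>r\<in>F. \<Sum>s\<in>F. ep p (s * (\<Sum>j\<in>I. c j * (r + int (f j)) ^ (p - 2))))"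
    by (subst sum.swap, subst (2) sum.swap, subst sum.swap) (rule refl)
  also have "\<dots> = (\<Sum>f\<in>Om. \<Sum>r\<in>F. if rel f r then of_nat p else 0)"
    unfolding F_def by (simp add: ep_orthogonality[OF p0] rel_def)
  also have "\<dots> = (\<Sum>f\<in>Om. of_nat (p * card {r \<in> F. rel f r}))"
    by (intro sum.cong refl) (simp add: F_def sum.inter_filter[symmetric])
  also have "\<dots> = complex_of_real (real (\<Sum>f\<in>Om. p * card {r \<in> F. rel f r}))"
    by simp
  finally have eq: "(\<Sum>s\<in>F. \<Sum>r\<in>F. cmod (recip_sum p V s r) ^ (2 * k)) =
      real (\<Sum>f\<in>Om. p * card {r \<in> F. rel f r})"
    by (simp only: of_real_eq_iff)
  have "(\<Sum>f\<in>Om. card {r \<in> F. rel f r}) =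
      (\<Sum>f\<in>D. card {r \<in> F. rel f r}) + (\<Sum>f\<in>Om - D. card {r \<in> F. rel f r})"
    using sum.subset_diff[of D Om] fin by (auto simp: D_def add.commute)
  also have "\<dots> \<le> (\<Sum>f\<in>D. p) + (\<Sum>f\<in>Om - D. 4 * k)"
  proof (intro add_mono sum_mono)
    fix f assume "f \<in> D"
    have "card {r \<in> F. rel f r} \<le> card F" by (intro card_mono) (auto simp: F_def)
    then show "card {r \<in> F. rel f r} \<le> p" using cardF by simp
  next
    fix f assume f: "f \<in> Om - D"
    then obtain i where i: "i \<in> I" "\<And>j. j \<in> I \<Longrightarrow> j \<noteq> i \<Longrightarrow> f j \<noteq> f i"
      by (auto simp: D_def)
    have "card {r \<in> {0..<int p}. int p dvd (\<Sum>j\<in>I. c j * (r + int (f j)) ^ (p - 2))} \<le> 2 * card I"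
    proof (rule card_roots_reciprocal_sum[OF p _ i(1)])
      show "\<not> int p dvd c i" using p by (auto simp: c_def)
      fix j assume j: "j \<in> I" "j \<noteq> i"
      \<comment> \<open>Because \<open>V < p\<close>, distinct shifts remain incongruent modulo
        \<open>p\<close>.\<close>
      have "f j \<in> {1..V}" "f i \<in> {1..V}" using f i(1) j(1) by (auto simp: Om_def)
      then have "\<bar>int (f j) - int (f i)\<bar> < int p" using V by auto
      moreover have "int (f j) - int (f i) \<noteq> 0" using i(2) j by simp
      ultimately show "\<not> int p dvd int (f j) - int (f i)"
        using dvd_imp_le_int[of "int (f j) - int (f i)" "int p"] by linarith
    qed (simp add: I_def)
    then show "card {r \<in> F. rel f r} \<le> 4 * k" by (simp add: rel_def F_def I_def)
  qed
  also have "\<dots> \<le> p * (V ^ k * k ^ (2 * k)) + 4 * k * V ^ (2 * k)"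
  proof -
    have "card D \<le> V ^ k * k ^ (2 * k)"
      unfolding D_def Om_def using card_all_repeated_le[of "{1..V}" I k] V by (simp add: I_def)
    moreover have "card (Om - D) \<le> card Om" using fin by (intro card_mono) auto
    moreover have "card Om = V ^ (2 * k)" by (simp add: Om_def card_PiE I_def)
    ultimately show ?thesis by (simp add: add_mono mult.commute)
  qed
  finally have "real (\<Sum>f\<in>Om. card {r \<in> F. rel f r}) \<le>
      real (p * (V ^ k * k ^ (2 * k)) + 4 * k * V ^ (2 * k))"
    by (rule of_nat_mono)
  then have "real p * real (\<Sum>f\<in>Om. card {r \<in> F. rel f r}) \<le>
      real p * real (p * (V ^ k * k ^ (2 * k)) + 4 * k * V ^ (2 * k))"
    by (rule mult_left_mono) simp
  moreover have "real (\<Sum>f\<in>Om. p * card {r \<in> F. rel f r}) = real p * real (\<Sum>f\<in>Om. card {r \<in> F. rel f r})"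
    by (simp add: sum_distrib_left)
  ultimately show ?thesis using eq by (simp add: F_def mult_ac)
qed

section \<open>Coincidences among fractions modulo a prime\<close>

lemma card_multiples_le:
  assumes "d > 0"
  shows "card {u \<in> {1..n}. d dvd u} \<le> n div d"
proof -
  have "card {u \<in> {1..n}. d dvd u} \<le> card {1..n div d}"
  proof (rule card_inj_on_le)
    show "inj_on (\<lambda>u. u div d) {u \<in> {1..n}. d dvd u}"
      by (auto intro!: inj_onI)
    show "(\<lambda>u. u div d) ` {u \<in> {1..n}. d dvd u} \<subseteq> {1..n div d}"
      using assms by (auto simp: div_le_mono Suc_le_eq div_greater_zero_iff dvd_imp_le)
  qed simp
  then show ?thesis by simp
qed

text \<open>The gcd is bounded by the sum of all common divisors \<open>d\<close>. After
  interchanging the sums, each \<open>d\<close> contributes at most \<open>d * (n / d)^2\<close>,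
  and the sum of \<open>1 / d\<close> is the harmonic number.\<close>

lemma sum_gcd_le:
  "(\<Sum>u\<in>{1..n}. \<Sum>v\<in>{1..n}. real (gcd u v)) \<le> real n ^ 2 * harm n"
proof -
  let ?m = "\<lambda>d. {u \<in> {1..n}. d dvd u}"
  have "(\<Sum>u\<in>{1..n}. \<Sum>v\<in>{1..n}. real (gcd u v)) \<le>
      (\<Sum>u\<in>{1..n}. \<Sum>v\<in>{1..n}. \<Sum>d\<in>{1..n}. real d * of_bool (d dvd u) * of_bool (d dvd v))"
  proof (intro sum_mono)
    fix u v assume "u \<in> {1..n}" "v \<in> {1..n}"
    then have "gcd u v \<in> {1..n}"
      by (auto simp: Suc_le_eq intro: order_trans[OF gcd_le1_nat])
    then show "real (gcd u v) \<le> (\<Sum>d\<in>{1..n}. real d * of_bool (d dvd u) * of_bool (d dvd v))"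
      by (intro order_trans[OF _ member_le_sum[of "gcd u v"]]) auto
  qed
  also have "\<dots> = (\<Sum>d\<in>{1..n}. \<Sum>u\<in>{1..n}. \<Sum>v\<in>{1..n}. real d * of_bool (d dvd u) * of_bool (d dvd v))"
    by (subst (2) sum.swap, subst sum.swap) (rule refl)
  also have "\<dots> = (\<Sum>d\<in>{1..n}. real d * real (card (?m d)) ^ 2)"
  proof (intro sum.cong refl)
    fix d
    have "(\<Sum>u\<in>{1..n}. of_bool (d dvd u)) = real (card (?m d))"
      by (simp add: of_bool_def sum.inter_filter[symmetric])
    then show "(\<Sum>u\<in>{1..n}. \<Sum>v\<in>{1..n}. real d * of_bool (d dvd u) * of_bool (d dvd v)) =
        real d * real (card (?m d)) ^ 2"
      by (simp add: sum_distrib_left[symmetric] sum_distrib_right[symmetric] power2_eq_square mult.assoc)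
  qed
  also have "\<dots> \<le> (\<Sum>d\<in>{1..n}. real n ^ 2 * inverse (real d))"
  proof (rule sum_mono)
    fix d assume "d \<in> {1..n}"
    then have d: "d > 0" by simp
    have "real (card (?m d)) \<le> real (n div d)"
      using card_multiples_le[OF d] by simp
    also have "\<dots> \<le> real n / real d" by (rule of_nat_div_le_of_nat)
    finally have "real d * real (card (?m d)) ^ 2 \<le> real d * (real n / real d) ^ 2"
      by (intro mult_left_mono power_mono) auto
    also have "\<dots> = real n ^ 2 * inverse (real d)"
      using d by (simp add: power2_eq_square field_simps)
    finally show "real d * real (card (?m d)) ^ 2 \<le> real n ^ 2 * inverse (real d)" .
  qed
  also have "\<dots> = real n ^ 2 * harm n"
    by (simp add: harm_def sum_distrib_left)
  finally show ?thesis .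
qed

text \<open>By coprimality the equation fixes \<open>y\<close> modulo \<open>b\<close>, so the
  quotient \<open>y div b\<close> determines \<open>y\<close>, and then \<open>y'\<close>.\<close>

lemma card_linear_equation_le:
  fixes a b :: nat and c :: int
  assumes "coprime a b" "b > 0"
  shows "card {(y, y'). y \<in> {1..Y} \<and> y' \<in> {1..Y::nat} \<and> int y * int a - int y' * int b = c} \<le> Y div b + 1"
    (is "card ?A \<le> _")
proof -
  have "card ?A \<le> card {0..Y div b}"
  proof (rule card_inj_on_le)
    show "inj_on (\<lambda>(y, y'). y div b) ?A"
    proof (rule inj_onI)
      fix w x assume wx: "w \<in> ?A" "x \<in> ?A" "(\<lambda>(y, y'). y div b) w = (\<lambda>(y, y'). y div b) x"
      then obtain y y' z z' where eq: "w = (y, y')" "x = (z, z')"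
        and y: "int y * int a - int y' * int b = c" and z: "int z * int a - int z' * int b = c"
        and d: "y div b = z div b" by auto
      have "int y * int a - int z * int a = (int y' - int z') * int b"
        using y z by (simp add: algebra_simps)
      then have "[int y * int a = int z * int a] (mod int b)"
        by (simp add: cong_iff_dvd_diff)
      then have "[y * a = z * a] (mod b)"
        by (metis cong_int_iff of_nat_mult)
      then have "[y = z] (mod b)"
        using assms(1) cong_mult_rcancel_nat by blast
      then have yz: "y = z" using d by (metis cong_def div_mult_mod_eq)
      have "int y' * int b = int z' * int b" using y z unfolding yz by linarith
      then show "w = x" using yz eq assms(2) by simp
    qed
    show "(\<lambda>(y, y'). y div b) ` ?A \<subseteq> {0..Y div b}"
      by (auto simp: div_le_mono)
  qed simp
  then show ?thesis by simp
qed

text \<open>With \<open>g = gcd u v\<close>, \<open>v = g * a\<close> and \<open>u = g * b\<close>,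
  the congruence becomes a family of equations \<open>y * a - z * b = p * t\<close> with about
  \<open>U * Y / (g * p)\<close> admissible \<open>t\<close>. Each has at most
  \<open>Y div b + 1\<close> solutions, a quantity of order \<open>Y * g / U\<close>. In the product
  the gcd cancels from the term with \<open>1 / p\<close>.\<close>

lemma card_ratio_congruence_pair:
  fixes u v U Y p :: nat
  assumes p: "prime p" "2 * U < p" and u: "u \<in> {U<..2*U}" and v: "v \<in> {U<..2*U}" and UY: "1 \<le> U" "U \<le> Y"
  shows "real (card {(y, z). y \<in> {1..Y} \<and> z \<in> {1..Y} \<and> [int y * int v = int z * int u] (mod int p)})
    \<le> 8 * real Y ^ 2 / real p + 2 * real Y * real (gcd u v) / real U"
proof -
  define g where "g = gcd u v"
  define a where "a = v div g"
  define b where "b = u div g"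
  have pos: "u > 0" "v > 0" "p > 0" using u v p by auto
  then have g: "g > 0" by (simp add: g_def)
  have va: "v = g * a" and ub: "u = g * b" by (simp_all add: a_def b_def g_def)
  then have ab0: "a > 0" "b > 0" using pos by auto
  have cop: "coprime a b"
    using pos div_gcd_coprime[of v u] by (simp add: a_def b_def g_def gcd.commute)
  have "g \<le> u" unfolding g_def using pos by simp
  then have gp: "\<not> int p dvd int g"
    using g u p by (auto dest!: dvd_imp_le)
  \<comment> \<open>Bound for the absolute value of \<open>t\<close>: both \<open>y * v\<close> and
    \<open>z * u\<close> lie between 0 and \<open>2 * U * Y\<close>, and their difference is
    \<open>g * p * t\<close>.\<close>
  define T where "T = 2 * U * Y div (g * p)"
  define A where "A = {(y, z). y \<in> {1..Y} \<and> z \<in> {1..Y} \<and> [int y * int v = int z * int u] (mod int p)}"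
  define B where "B t = {(y, z). y \<in> {1..Y} \<and> z \<in> {1..Y} \<and> int y * int a - int z * int b = int p * t}" for t
  have finB: "finite (B t)" for t
    by (rule finite_subset[of _ "{1..Y} \<times> {1..Y}"]) (auto simp: B_def)
  have "A \<subseteq> (\<Union>t\<in>{- int T..int T}. B t)"
  proof
    fix x assume "x \<in> A"
    then obtain y z where x: "x = (y, z)" and yz: "y \<in> {1..Y}" "z \<in> {1..Y}"
      and c: "[int y * int v = int z * int u] (mod int p)" by (auto simp: A_def)
    have "int y * int v - int z * int u = int g * (int y * int a - int z * int b)"
      by (simp add: va ub algebra_simps)
    then have "int p dvd int g * (int y * int a - int z * int b)"
      using c by (simp add: cong_iff_dvd_diff)
    then have "int p dvd int y * int a - int z * int b"
      using gp p by (simp add: prime_dvd_mult_iff)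
    then obtain t where t: "int y * int a - int z * int b = int p * t" ..
    have "int g * (int y * int a) \<le> int (2 * U * Y)"
    proof -
      have "y * v \<le> Y * (2 * U)" using yz v by (intro mult_mono) auto
      then show ?thesis by (simp add: va mult_ac flip: of_nat_mult)
    qed
    moreover have "int g * (int z * int b) \<le> int (2 * U * Y)"
    proof -
      have "z * u \<le> Y * (2 * U)" using yz u by (intro mult_mono) auto
      then show ?thesis by (simp add: ub mult_ac flip: of_nat_mult)
    qed
    moreover have "0 \<le> int g * (int y * int a)" "0 \<le> int g * (int z * int b)" by simp_all
    moreover have "int g * (int p * t) = int g * (int y * int a) - int g * (int z * int b)"
      by (simp only: t[symmetric] right_diff_distrib)
    ultimately have "\<bar>int g * (int p * t)\<bar> \<le> int (2 * U * Y)" by linarith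
    then have "\<bar>t\<bar> * int (g * p) \<le> int (2 * U * Y)"
      by (simp add: abs_mult mult_ac)
    from zdiv_mono1[OF this, of "int (g * p)"]
    have "\<bar>t\<bar> \<le> int (2 * U * Y) div int (g * p)"
      using g pos by simp
    then have "\<bar>t\<bar> \<le> int T" by (simp only: T_def zdiv_int)
    then have "t \<in> {- int T..int T}" by auto
    moreover have "x \<in> B t" using x yz t by (simp add: B_def)
    ultimately show "x \<in> (\<Union>t\<in>{- int T..int T}. B t)" by blast
  qed
  then have "card A \<le> card (\<Union>t\<in>{- int T..int T}. B t)"
    using finB by (intro card_mono finite_UN_I) auto
  also have "\<dots> \<le> (\<Sum>t\<in>{- int T..int T}. card (B t))" by (rule card_UN_le) simp
  also have "\<dots> \<le> (\<Sum>t\<in>{- int T..int T}. Y div b + 1)"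
    unfolding B_def by (intro sum_mono card_linear_equation_le cop ab0)
  also have "\<dots> = (2 * T + 1) * (Y div b + 1)"
  proof -
    have "card {- int T..int T} = 2 * T + 1" by (simp add: nat_eq_iff)
    then show ?thesis by (simp only: sum_constant) simp
  qed
  finally have "real (card A) \<le> real ((2 * T + 1) * (Y div b + 1))" by (rule of_nat_mono)
  then have "real (card A) \<le> (2 * real T + 1) * (real (Y div b) + 1)"
    by (simp add: algebra_simps)
  also have "\<dots> \<le> (4 * real U * real Y / (real g * real p) + 1) * (2 * real Y * real g / real U)"
  proof (intro mult_mono)
    have "real T \<le> real (2 * U * Y) / real (g * p)" unfolding T_def by (rule of_nat_div_le_of_nat)
    then show "2 * real T + 1 \<le> 4 * real U * real Y / (real g * real p) + 1" by simp
    have "real (Y div b) \<le> real Y / real b" by (rule of_nat_div_le_of_nat)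
    also have "\<dots> = real Y * real g / real u" using g ab0 by (simp add: ub)
    also have "\<dots> \<le> real Y * real g / real U"
      using u UY by (intro divide_left_mono) auto
    finally have 1: "real (Y div b) \<le> real Y * real g / real U" .
    \<comment> \<open>Here \<open>U \<le> Y\<close> lets the additional 1 be absorbed, at the cost
      of a factor 2.\<close>
    have "real U * 1 \<le> real Y * real g" using UY g by (intro mult_mono) auto
    then have "1 \<le> real Y * real g / real U" using UY by (simp add: field_simps)
    then show "real (Y div b) + 1 \<le> 2 * real Y * real g / real U" using 1 by simp
  qed auto
  also have "\<dots> = 8 * real Y ^ 2 / real p + 2 * real Y * real g / real U"
    using g pos UY by (simp add: field_simps power2_eq_square)
  finally show ?thesis by (simp add: A_def g_def)
qed

text \<open>Coincidences \<open>y / u = z / v\<close> of fractions modulo \<open>p\<close>,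
  cross-multiplied; in each pair the denominator comes first.\<close>

definition ratio_pairs :: "nat \<Rightarrow> nat \<Rightarrow> nat \<Rightarrow> ((nat \<times> nat) \<times> (nat \<times> nat)) set" where
  "ratio_pairs p U Y = {((u, y), (v, z)). u \<in> {U<..2*U} \<and> v \<in> {U<..2*U} \<and> y \<in> {1..Y} \<and> z \<in> {1..Y}
     \<and> [int y * int v = int z * int u] (mod int p)}"

text \<open>The previous bound is summed over both denominators, with the average of the gcd
  controlled by \<open>sum_gcd_le\<close>. Up to a constant, the first term is what
  \<open>U * Y\<close> random residues would give.\<close>

lemma card_ratio_pairs:
  assumes p: "prime p" "2 * U < p" and UY: "1 \<le> U" "U \<le> Y"
  shows "finite (ratio_pairs p U Y)"
    and "real (card (ratio_pairs p U Y)) \<le>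
      8 * real U ^ 2 * real Y ^ 2 / real p + 8 * real Y * real U * harm (2 * U)"
proof -
  show fin: "finite (ratio_pairs p U Y)"
    by (rule finite_subset[of _ "({U<..2*U} \<times> {1..Y}) \<times> ({U<..2*U} \<times> {1..Y})"])
       (auto simp: ratio_pairs_def)
  define A where "A u v = {(y, z). y \<in> {1..Y} \<and> z \<in> {1..Y} \<and> [int y * int v = int z * int u] (mod int p)}" for u v
  have finA: "finite (A u v)" for u v
    by (rule finite_subset[of _ "{1..Y} \<times> {1..Y}"]) (auto simp: A_def)
  have "card (ratio_pairs p U Y) \<le> card (SIGMA u:{U<..2*U}. SIGMA v:{U<..2*U}. A u v)"
    by (rule card_inj_on_le[where f = "\<lambda>((u, y), (v, z)). (u, v, y, z)"])
       (auto simp: ratio_pairs_def A_def inj_on_def intro!: finite_SigmaI finA[unfolded A_def, simplified])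
  also have "\<dots> = (\<Sum>u\<in>{U<..2*U}. \<Sum>v\<in>{U<..2*U}. card (A u v))"
    by (subst card_SigmaI) (auto intro!: sum.cong card_SigmaI finA finite_SigmaI)
  finally have "real (card (ratio_pairs p U Y)) \<le> (\<Sum>u\<in>{U<..2*U}. \<Sum>v\<in>{U<..2*U}. real (card (A u v)))"
    by (simp flip: of_nat_sum)
  also have "\<dots> \<le> (\<Sum>u\<in>{U<..2*U}. \<Sum>v\<in>{U<..2*U}.
      8 * real Y ^ 2 / real p + 2 * real Y / real U * real (gcd u v))"
  proof (intro sum_mono)
    fix u v assume "u \<in> {U<..2*U}" "v \<in> {U<..2*U}"
    from card_ratio_congruence_pair[OF p this UY]
    show "real (card (A u v)) \<le> 8 * real Y ^ 2 / real p + 2 * real Y / real U * real (gcd u v)"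
      by (simp add: A_def)
  qed
  also have "\<dots> = real U ^ 2 * (8 * real Y ^ 2 / real p) +
      2 * real Y / real U * (\<Sum>u\<in>{U<..2*U}. \<Sum>v\<in>{U<..2*U}. real (gcd u v))"
    by (simp add: sum.distrib sum_distrib_left power2_eq_square)
  finally have le: "real (card (ratio_pairs p U Y)) \<le> real U ^ 2 * (8 * real Y ^ 2 / real p) +
      2 * real Y / real U * (\<Sum>u\<in>{U<..2*U}. \<Sum>v\<in>{U<..2*U}. real (gcd u v))" .
  have "(\<Sum>u\<in>{U<..2*U}. \<Sum>v\<in>{U<..2*U}. real (gcd u v)) \<le>
      (\<Sum>u\<in>{1..2*U}. \<Sum>v\<in>{1..2*U}. real (gcd u v))"
    by (rule order_trans[OF sum_mono[OF sum_mono2] sum_mono2]) (auto intro: sum_nonneg)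
  also have "\<dots> \<le> real (2 * U) ^ 2 * harm (2 * U)" by (rule sum_gcd_le)
  finally have "2 * real Y / real U * (\<Sum>u\<in>{U<..2*U}. \<Sum>v\<in>{U<..2*U}. real (gcd u v)) \<le>
      2 * real Y / real U * (real (2 * U) ^ 2 * harm (2 * U))"
    by (rule mult_left_mono) simp
  with le have "real (card (ratio_pairs p U Y)) \<le> real U ^ 2 * (8 * real Y ^ 2 / real p) +
      2 * real Y / real U * (real (2 * U) ^ 2 * harm (2 * U))" by linarith
  also have "real U ^ 2 * (8 * real Y ^ 2 / real p) + 2 * real Y / real U * (real (2 * U) ^ 2 * harm (2 * U)) =
      8 * real U ^ 2 * real Y ^ 2 / real p + 8 * real Y * real U * harm (2 * U)"
    using UY by (simp add: field_simps power2_eq_square)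
  finally show "real (card (ratio_pairs p U Y)) \<le>
      8 * real U ^ 2 * real Y ^ 2 / real p + 8 * real Y * real U * harm (2 * U)" .
qed

section \<open>Incomplete Kloosterman sums on average\<close>

lemma power_mean_sum:
  fixes g :: "'a \<Rightarrow> real"
  assumes "finite X" "\<And>x. x \<in> X \<Longrightarrow> g x \<ge> 0" "k \<ge> 1"
  shows "(\<Sum>x\<in>X. g x) ^ k \<le> real (card X) ^ (k - 1) * (\<Sum>x\<in>X. g x ^ k)"
proof (cases "X = {}")
  case False
  define n where "n = real (card X)"
  have n: "n > 0" using False assms(1) by (simp add: n_def card_gt_0_iff)
  have conv: "convex_on {0::real..} (\<lambda>x. x ^ k)"
    by (cases "even k") (auto intro: convex_power_odd convex_on_subset[OF convex_power_even])
  have "(\<Sum>x\<in>X. (1 / n) *\<^sub>R g x) ^ k \<le> (\<Sum>x\<in>X. (1 / n) * g x ^ k)"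
    by (rule convex_on_sum[OF assms(1) False conv]) (use n assms in \<open>auto simp: n_def\<close>)
  then have "(\<Sum>x\<in>X. g x) ^ k / n ^ k \<le> (\<Sum>x\<in>X. g x ^ k) / n"
    by (simp add: sum_divide_distrib[symmetric] power_divide)
  then have "(\<Sum>x\<in>X. g x) ^ k \<le> (\<Sum>x\<in>X. g x ^ k) / n * n ^ k"
    using n by (simp add: pos_divide_le_eq)
  also have "n ^ k = n * n ^ (k - 1)" using assms(3) by (simp add: power_eq_if)
  finally show ?thesis using n by (simp add: n_def mult.commute)
qed (use assms in \<open>auto simp: power_0_left\<close>)

text \<open>Hoelder's inequality for the multiplicity function of \<open>\<phi>\<close>, whose second moment is the number
  of collisions.\<close>

lemma holder_collisions:
  fixes h :: "'b \<Rightarrow> real"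
  assumes X: "finite X" and Z: "finite Z" "\<phi> ` X \<subseteq> Z" and h: "\<And>z. h z \<ge> 0" and k: "k \<ge> 1"
  shows "(\<Sum>x\<in>X. h (\<phi> x)) ^ (2 * k) \<le>
    real (card X) ^ (2 * k - 2) * real (card {(x, x') \<in> X \<times> X. \<phi> x = \<phi> x'}) * (\<Sum>z\<in>Z. h z ^ (2 * k))"
proof -
  define \<nu> where "\<nu> z = real (card {x \<in> X. \<phi> x = z})" for z
  have fib: "(\<Sum>x\<in>X. f (\<phi> x)) = (\<Sum>z\<in>Z. \<nu> z * f z)" for f :: "'b \<Rightarrow> real"
  proof -
    have "(\<Sum>x\<in>X. f (\<phi> x)) = (\<Sum>z\<in>Z. \<Sum>x\<in>{x \<in> X. \<phi> x = z}. f (\<phi> x))"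
      using sum.group[OF X Z, of "\<lambda>x. f (\<phi> x)"] by simp
    also have "\<dots> = (\<Sum>z\<in>Z. \<nu> z * f z)"
      by (intro sum.cong refl) (simp add: \<nu>_def)
    finally show ?thesis .
  qed
  have "{(x, x') \<in> X \<times> X. \<phi> x = \<phi> x'} = (SIGMA x:X. {x' \<in> X. \<phi> x' = \<phi> x})" by auto
  then have "real (card {(x, x') \<in> X \<times> X. \<phi> x = \<phi> x'}) = (\<Sum>x\<in>X. \<nu> (\<phi> x))"
    using X by (simp add: \<nu>_def card_SigmaI)
  also have "\<dots> = (\<Sum>z\<in>Z. (\<nu> z)\<^sup>2)" by (simp add: fib power2_eq_square)
  finally have E: "real (card {(x, x') \<in> X \<times> X. \<phi> x = \<phi> x'}) = (\<Sum>z\<in>Z. (\<nu> z)\<^sup>2)" .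
  \<comment> \<open>The exponent is split as \<open>k\<close> times 2: the power mean inequality
    handles \<open>k\<close>, and Cauchy-Schwarz then separates the multiplicities from the values
    \<open>h z ^ k\<close>.\<close>
  have "(\<Sum>x\<in>X. h (\<phi> x)) ^ (2 * k) = ((\<Sum>x\<in>X. h (\<phi> x)) ^ k)\<^sup>2"
    by (simp add: power_mult[symmetric] mult.commute)
  also have "\<dots> \<le> (real (card X) ^ (k - 1) * (\<Sum>x\<in>X. h (\<phi> x) ^ k))\<^sup>2"
    by (intro power_mono power_mean_sum) (use X h k in \<open>auto intro!: sum_nonneg zero_le_power\<close>)
  also have "\<dots> = real (card X) ^ (2 * k - 2) * (\<Sum>x\<in>X. h (\<phi> x) ^ k)\<^sup>2"
  proof -
    have "(k - 1) * 2 = 2 * k - 2" by simp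
    then show ?thesis by (simp only: power_mult_distrib power_mult[symmetric])
  qed
  also have "(\<Sum>x\<in>X. h (\<phi> x) ^ k) = (\<Sum>z\<in>Z. \<nu> z * h z ^ k)"
    by (rule fib)
  also have "real (card X) ^ (2 * k - 2) * (\<Sum>z\<in>Z. \<nu> z * h z ^ k)\<^sup>2 \<le>
      real (card X) ^ (2 * k - 2) * ((\<Sum>z\<in>Z. (\<nu> z)\<^sup>2) * (\<Sum>z\<in>Z. (h z ^ k)\<^sup>2))"
    by (intro mult_left_mono Cauchy_Schwarz_ineq_sum) simp
  finally show ?thesis
    unfolding E by (simp only: power_mult[symmetric] mult_ac)
qed

text \<open>A shift by one changes only the two end terms, each of absolute value at most 1.\<close>

lemma norm_sum_shift_le:
  fixes f :: "nat \<Rightarrow> complex"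
  assumes "\<And>y. cmod (f y) \<le> 1"
  shows "cmod ((\<Sum>y\<in>{1..Y}. f y) - (\<Sum>y\<in>{1..Y}. f (y + h))) \<le> 2 * real h"
proof (induction h)
  case (Suc h)
  have tel: "(\<Sum>y\<in>{1..Y}. g y) - (\<Sum>y\<in>{1..Y}. g (Suc y)) = g 1 - g (Suc Y)" for g :: "nat \<Rightarrow> complex"
  proof (induction Y)
    case (Suc Y)
    then show ?case by (simp add: algebra_simps)
  qed simp
  have "(\<Sum>y\<in>{1..Y}. f (y + h)) - (\<Sum>y\<in>{1..Y}. f (y + Suc h)) = f (1 + h) - f (Suc Y + h)"
    using tel[of "\<lambda>y. f (y + h)"] by simp
  moreover have "cmod (f (1 + h) - f (Suc Y + h)) \<le> 1 + 1"
    by (rule order_trans[OF norm_triangle_ineq4 add_mono]) (rule assms)+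
  ultimately have "cmod ((\<Sum>y\<in>{1..Y}. f (y + h)) - (\<Sum>y\<in>{1..Y}. f (y + Suc h))) \<le> 2" by simp
  with Suc.IH have "cmod (((\<Sum>y\<in>{1..Y}. f y) - (\<Sum>y\<in>{1..Y}. f (y + h))) +
     ((\<Sum>y\<in>{1..Y}. f (y + h)) - (\<Sum>y\<in>{1..Y}. f (y + Suc h)))) \<le> 2 * real h + 2"
    by (intro order_trans[OF norm_triangle_ineq add_mono])
  then show ?case by simp
qed simp

definition kl_sum :: "nat \<Rightarrow> nat \<Rightarrow> int \<Rightarrow> complex" where
  "kl_sum p Y a = (\<Sum>y\<in>{1..Y}. ep p (a * int y ^ (p - 2)))"

text \<open>This is \<open>a / (y + u v) = (a / u) / (y / u + v)\<close>. As the inverse is a power,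
  it remains true when \<open>p\<close> divides \<open>y + u * v\<close>. Reducing
  \<open>a / u\<close> and \<open>y / u\<close> places both in \<open>{0..<int p}\<close>, the range
  over which the moment is completed.\<close>

lemma ep_shifted_reciprocal:
  assumes p: "prime p" "p > 2" and u: "\<not> int p dvd u"
  shows "ep p (a * (y + u * v) ^ (p - 2)) =
    ep p ((a * u ^ (p - 2) mod int p) * ((y * u ^ (p - 2) mod int p) + v) ^ (p - 2))"
proof (rule ep_cong)
  define w where "w = u ^ (p - 2)"
  have uw: "[u * w = 1] (mod int p)"
    unfolding w_def by (rule prime_fermat_inverse[OF p u])
  have "[y * 1 + u * v = y * (u * w) + u * v] (mod int p)"
    by (intro cong_add cong_mult cong_refl) (rule cong_sym[OF uw])
  then have "[y + u * v = u * (y * w + v)] (mod int p)"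
    by (simp add: algebra_simps)
  then have "[a * (y + u * v) ^ (p - 2) = a * (u * (y * w + v)) ^ (p - 2)] (mod int p)"
    by (intro cong_mult cong_pow cong_refl)
  also have "a * (u * (y * w + v)) ^ (p - 2) = (a * w) * (y * w + v) ^ (p - 2)"
    by (simp add: w_def power_mult_distrib mult_ac)
  also have "[\<dots> = (a * w mod int p) * ((y * w mod int p) + v) ^ (p - 2)] (mod int p)"
    by (intro cong_mult cong_pow cong_add cong_refl) (simp_all add: cong_def)
  finally show "[a * (y + u * v) ^ (p - 2) =
      (a * u ^ (p - 2) mod int p) * ((y * u ^ (p - 2) mod int p) + v) ^ (p - 2)] (mod int p)"
    by (simp only: w_def)
qed (use p in simp)

lemma not_dvd_dyadic:
  assumes "2 * U < p" "u \<in> {U<..2*U::nat}"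
  shows "\<not> int p dvd int u"
proof
  assume "int p dvd int u"
  then have "p dvd u" by simp
  then have "p \<le> u" using assms(2) by (intro dvd_imp_le) auto
  with assms show False by simp
qed

text \<open>The sum is compared with its shifts by all products \<open>u * v\<close>, of which there
  are \<open>U * V\<close>. A shift is at most \<open>2 * U * V\<close>, so each comparison costs at
  most \<open>4 * U * V\<close>. The sum over \<open>v\<close> is then taken innermost.\<close>

lemma norm_kl_sum_le_shifts:
  assumes p: "prime p" "p > 2" "2 * U < p"
  shows "real U * real V * cmod (kl_sum p Y a) \<le>
    (\<Sum>u\<in>{U<..2*U}. \<Sum>y\<in>{1..Y}.
       cmod (recip_sum p V (a * int u ^ (p - 2) mod int p) (int y * int u ^ (p - 2) mod int p)))
    + real U * real V * (4 * real U * real V)"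
proof -
  define f where "f y = ep p (a * int y ^ (p - 2))" for y
  have K: "kl_sum p Y a = (\<Sum>y\<in>{1..Y}. f y)" by (simp add: kl_sum_def f_def)
  define T where "T = (\<Sum>u\<in>{U<..2*U}. \<Sum>v\<in>{1..V}. \<Sum>y\<in>{1..Y}. f (y + u * v))"
  have "of_nat U * of_nat V * kl_sum p Y a - T =
      (\<Sum>u\<in>{U<..2*U}. \<Sum>v\<in>{1..V}. (\<Sum>y\<in>{1..Y}. f y) - (\<Sum>y\<in>{1..Y}. f (y + u * v)))"
    by (simp add: sum_subtractf T_def K)
  also have "cmod \<dots> \<le> (\<Sum>u\<in>{U<..2*U}. \<Sum>v\<in>{1..V}. 4 * real U * real V)"
  proof (intro sum_norm_le)
    fix u v assume uv: "u \<in> {U<..2*U}" "v \<in> {1..V}"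
    have "cmod ((\<Sum>y\<in>{1..Y}. f y) - (\<Sum>y\<in>{1..Y}. f (y + u * v))) \<le> 2 * real (u * v)"
      by (rule norm_sum_shift_le) (simp add: f_def)
    also have "u * v \<le> (2 * U) * V" using uv by (intro mult_mono) auto
    then have "2 * real (u * v) \<le> 2 * real ((2 * U) * V)" by (simp only: of_nat_le_iff mult_le_cancel_left) simp
    finally show "cmod ((\<Sum>y\<in>{1..Y}. f y) - (\<Sum>y\<in>{1..Y}. f (y + u * v))) \<le> 4 * real U * real V"
      by simp
  qed
  finally have 1: "cmod (of_nat U * of_nat V * kl_sum p Y a - T) \<le> real U * real V * (4 * real U * real V)"
    by simp
  have T: "T = (\<Sum>u\<in>{U<..2*U}. \<Sum>y\<in>{1..Y}. \<Sum>v\<in>{1..V}. f (y + u * v))"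
    unfolding T_def by (intro sum.cong refl sum.swap)
  have 2: "cmod T \<le> (\<Sum>u\<in>{U<..2*U}. \<Sum>y\<in>{1..Y}.
       cmod (recip_sum p V (a * int u ^ (p - 2) mod int p) (int y * int u ^ (p - 2) mod int p)))"
    unfolding T
  proof (intro sum_norm_le)
    fix u y assume "u \<in> {U<..2*U}"
    note u = not_dvd_dyadic[OF p(3) this]
    have "(\<Sum>v\<in>{1..V}. f (y + u * v)) =
        recip_sum p V (a * int u ^ (p - 2) mod int p) (int y * int u ^ (p - 2) mod int p)"
      unfolding recip_sum_def f_def
      using ep_shifted_reciprocal[OF p(1,2) u, of a "int y"] by (intro sum.cong refl) simp
    then show "cmod (\<Sum>v\<in>{1..V}. f (y + u * v)) \<le>
        cmod (recip_sum p V (a * int u ^ (p - 2) mod int p) (int y * int u ^ (p - 2) mod int p))"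
      by simp
  qed
  have "real U * real V * cmod (kl_sum p Y a) = cmod (of_nat U * of_nat V * kl_sum p Y a)"
    by (simp only: norm_mult norm_of_nat)
  also have "\<dots> \<le> cmod T + cmod (of_nat U * of_nat V * kl_sum p Y a - T)"
    by (rule norm_triangle_sub)
  finally show ?thesis using 1 2 by linarith
qed

text \<open>Equality of second coordinates is a coincidence of fractions. Given it, equality of the
  first coordinates determines \<open>a\<close> from \<open>b\<close>, \<open>u\<close> and
  \<open>v\<close>, so forgetting \<open>a\<close> is injective and only the factor
  \<open>card D\<close> remains.\<close>

lemma card_collisions_le:
  fixes D :: "int set"
  assumes p: "prime p" "p > 2" "2 * U < p" and UY: "1 \<le> U" "U \<le> Y"
    and D: "finite D" "inj_on (\<lambda>a. a mod int p) D"
  defines "X \<equiv> D \<times> {U<..2*U} \<times> {1..Y}"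
    and "\<phi> \<equiv> \<lambda>(a, u, y). (a * int u ^ (p - 2) mod int p, int y * int u ^ (p - 2) mod int p)"
  shows "real (card {(x, x') \<in> X \<times> X. \<phi> x = \<phi> x'}) \<le>
    real (card D) * (8 * real U ^ 2 * real Y ^ 2 / real p + 8 * real Y * real U * harm (2 * U))"
proof -
  define g :: "(int \<times> nat \<times> nat) \<times> (int \<times> nat \<times> nat) \<Rightarrow> int \<times> (nat \<times> nat) \<times> nat \<times> nat"
    where "g = (\<lambda>((a, u, y), (b, v, z)). (b, (u, y), (v, z)))"
  let ?C = "{(x, x') \<in> X \<times> X. \<phi> x = \<phi> x'}"
  have "card ?C \<le> card (D \<times> ratio_pairs p U Y)"
  proof (rule card_inj_on_le)
    show "inj_on g ?C"
    proof (rule inj_onI)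
      fix w w' assume w: "w \<in> ?C" "w' \<in> ?C" "g w = g w'"
      then obtain a a' b u y v z where eq: "w = ((a, u, y), (b, v, z))" "w' = ((a', u, y), (b, v, z))"
        by (auto simp: g_def split: prod.splits)
      have "a * int u ^ (p - 2) mod int p = a' * int u ^ (p - 2) mod int p"
        using w unfolding eq by (simp add: \<phi>_def)
      then have c: "[a * int u ^ (p - 2) = a' * int u ^ (p - 2)] (mod int p)" by (simp add: cong_def)
      have "u \<in> {U<..2*U}" using w eq by (simp add: X_def)
      from not_dvd_dyadic[OF p(3) this] have "coprime (int p) (int u)"
        using p(1) by (intro prime_imp_coprime) auto
      then have "coprime (int u ^ (p - 2)) (int p)"
        by (simp add: coprime_commute)
      then have "[a = a'] (mod int p)" using c cong_mult_rcancel by blast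
      moreover have "a \<in> D" "a' \<in> D" using w unfolding eq by (auto simp: X_def)
      ultimately have "a = a'" using D(2) by (auto simp: inj_on_def cong_def)
      then show "w = w'" using eq by simp
    qed
    show "g ` ?C \<subseteq> D \<times> ratio_pairs p U Y"
    proof
      fix q assume "q \<in> g ` ?C"
      then obtain a u y b v z where q: "q = (b, (u, y), (v, z))"
        and mem: "b \<in> D" "u \<in> {U<..2*U}" "y \<in> {1..Y}" "v \<in> {U<..2*U}" "z \<in> {1..Y}"
        and e: "int y * int u ^ (p - 2) mod int p = int z * int v ^ (p - 2) mod int p"
        by (auto simp: g_def X_def \<phi>_def)
      define u' v' where "u' = int u ^ (p - 2)" and "v' = int v ^ (p - 2)"
      have u': "[int u * u' = 1] (mod int p)" and v': "[int v * v' = 1] (mod int p)"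
        unfolding u'_def v'_def
        by (rule prime_fermat_inverse[OF p(1,2) not_dvd_dyadic[OF p(3) mem(2)]],
            rule prime_fermat_inverse[OF p(1,2) not_dvd_dyadic[OF p(3) mem(4)]])
      have e': "[int y * u' = int z * v'] (mod int p)"
        using e by (simp add: cong_def u'_def v'_def)
      \<comment> \<open>Clearing denominators: the equality \<open>y / u = z / v\<close> is
        multiplied by \<open>u * v\<close>.\<close>
      have "[int y * int v * 1 = int y * int v * (int u * u')] (mod int p)"
        by (intro cong_mult cong_refl) (rule cong_sym[OF u'])
      also have "int y * int v * (int u * u') = int u * int v * (int y * u')" by (simp add: mult_ac)
      also have "[\<dots> = int u * int v * (int z * v')] (mod int p)"
        by (intro cong_mult cong_refl e')
      also have "int u * int v * (int z * v') = int z * int u * (int v * v')" by (simp add: mult_ac)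
      also have "[\<dots> = int z * int u * 1] (mod int p)"
        by (intro cong_mult cong_refl v')
      finally show "q \<in> D \<times> ratio_pairs p U Y"
        using mem by (simp add: q ratio_pairs_def)
    qed
    show "finite (D \<times> ratio_pairs p U Y)"
      using D(1) card_ratio_pairs(1)[OF p(1,3) UY] by simp
  qed
  then have "real (card ?C) \<le> real (card D) * real (card (ratio_pairs p U Y))"
    by (simp add: card_cartesian_product flip: of_nat_mult)
  also have "\<dots> \<le> real (card D) * (8 * real U ^ 2 * real Y ^ 2 / real p + 8 * real Y * real U * harm (2 * U))"
    by (intro mult_left_mono card_ratio_pairs(2)[OF p(1,3) UY]) simp
  finally show ?thesis .
qed

text \<open>Shifting, Hoelder's inequality with the collision count, and the completed moment are
  combined. The powr factor measures the gain over the trivial bound \<open>M * Y\<close>; the last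
  term is the cost of shifting.\<close>

lemma sum_norm_kl_sum_le:
  fixes D :: "int set"
  assumes p: "prime p" "p > 2" "2 * U < p" and V: "1 \<le> V" "V < p" and UY: "1 \<le> U" "U \<le> Y"
    and D: "finite D" "D \<noteq> {}" "inj_on (\<lambda>a. a mod int p) D" and k: "k \<ge> 1"
  defines "M \<equiv> real (card D)"
  shows "(\<Sum>a\<in>D. cmod (kl_sum p Y a)) \<le> M * real Y *
      ((8 / M + 8 * real p * harm (2 * U) / (M * real Y * real U)) *
       (real p * real k ^ (2 * k) / real V ^ k + 4 * real k)) powr (1 / (2 * real k))
    + 4 * M * real U * real V"
proof -
  define B where "B = (8 / M + 8 * real p * harm (2 * U) / (M * real Y * real U)) *
       (real p * real k ^ (2 * k) / real V ^ k + 4 * real k)"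
  define X where "X = D \<times> {U<..2*U} \<times> {1..Y}"
  define \<phi> where "\<phi> = (\<lambda>(a, u, y). (a * int u ^ (p - 2) mod int p, int y * int u ^ (p - 2) mod int p))"
  define Z where "Z = {0..<int p} \<times> {0..<int p}"
  define h where "h z = cmod (recip_sum p V (fst z) (snd z))" for z
  define Q where "Q = (\<Sum>x\<in>X. h (\<phi> x))"
  define R where "R = 8 * real U ^ 2 * real Y ^ 2 / real p + 8 * real Y * real U * harm (2 * U)"
  define L where "L = real p * (real p * real V ^ k * real k ^ (2 * k) + 4 * real k * real V ^ (2 * k))"
  have M: "M > 0" using D by (simp add: M_def card_gt_0_iff)
  have pos: "real U > 0" "real V > 0" "real Y > 0" "real p > 0" using UY V p by auto
  have H: "harm (2 * U) \<ge> (0::real)" by (rule harm_nonneg)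
  have B0: "B \<ge> 0" unfolding B_def using M H by (intro mult_nonneg_nonneg add_nonneg_nonneg divide_nonneg_nonneg) auto
  have finX: "finite X" using D by (simp add: X_def)
  have cardX: "real (card X) = M * real U * real Y"
    by (simp add: X_def card_cartesian_product M_def)
  have Q0: "Q \<ge> 0" unfolding Q_def h_def by (intro sum_nonneg) simp
  have "Q ^ (2 * k) \<le> real (card X) ^ (2 * k - 2) *
      real (card {(x, x') \<in> X \<times> X. \<phi> x = \<phi> x'}) * (\<Sum>z\<in>Z. h z ^ (2 * k))"
    unfolding Q_def
    by (rule holder_collisions) (use finX k p in \<open>auto simp: Z_def \<phi>_def h_def\<close>)
  also have "\<dots> \<le> real (card X) ^ (2 * k - 2) * (M * R) * L"
  proof (intro mult_mono order_refl)
    show "real (card {(x, x') \<in> X \<times> X. \<phi> x = \<phi> x'}) \<le> M * R"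
      unfolding M_def R_def X_def \<phi>_def by (rule card_collisions_le[OF p UY D(1,3)])
    show "(\<Sum>z\<in>Z. h z ^ (2 * k)) \<le> L"
      using recip_sum_moment[OF p(1,2) V, of k] unfolding L_def Z_def h_def
      by (simp add: sum.cartesian_product case_prod_beta)
    show "0 \<le> real (card X) ^ (2 * k - 2) * (M * R)" unfolding R_def using M H by simp
    show "0 \<le> (\<Sum>z\<in>Z. h z ^ (2 * k))" by (intro sum_nonneg) (simp add: h_def)
  qed auto
  also have "\<dots> = (M * real Y * real U * real V) ^ (2 * k) * B"
  proof -
    \<comment> \<open>Normalisation: \<open>c1\<close> is the collision bound times
      \<open>p / (card X)^2\<close>, and \<open>c2\<close> is the moment bound divided by
      \<open>p * V ^ (2 * k)\<close>. The two powers of \<open>p\<close> cancel in the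
      product.\<close>
    define A G c1 c2 where "A = real (card X) ^ (2 * k - 2)" and "G = (M * real U * real Y)\<^sup>2"
      and "c1 = 8 / M + 8 * real p * harm (2 * U) / (M * real Y * real U)"
      and "c2 = real p * real k ^ (2 * k) / real V ^ k + 4 * real k"
    have "real (card X) ^ (2 * k) = A * G"
    proof -
      have "2 * k - 2 + 2 = 2 * k" using k by simp
      then show ?thesis unfolding A_def G_def cardX[symmetric] by (simp only: power_add[symmetric])
    qed
    moreover have "M * real Y * real U * real V = real (card X) * real V" by (simp add: cardX)
    moreover have "B = c1 * c2" by (simp only: B_def c1_def c2_def)
    ultimately have "(M * real Y * real U * real V) ^ (2 * k) * B = A * (G * c1) * (real V ^ (2 * k) * c2)"
      by (simp only: power_mult_distrib mult_ac)
    also have "G * c1 = real p * (M * R)"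
      using M pos by (simp add: G_def c1_def R_def field_simps power2_eq_square)
    also have "A * (real p * (M * R)) * (real V ^ (2 * k) * c2) =
        A * (M * R) * (real p * (real V ^ (2 * k) * c2))"
      by (simp only: mult_ac)
    also have "real V ^ (2 * k) * c2 = real p * real V ^ k * real k ^ (2 * k) + 4 * real k * real V ^ (2 * k)"
      using pos by (simp add: c2_def mult_2 power_add distrib_left)
    finally show ?thesis unfolding L_def A_def ..
  qed
  finally have le: "Q ^ (2 * k) \<le> (M * real Y * real U * real V) ^ (2 * k) * B" .
  have "B = (B powr (1 / (2 * real k))) ^ (2 * k)"
  proof (cases "B = 0")
    case False
    then have "(B powr (1 / (2 * real k))) ^ (2 * k) = B powr (of_nat (2 * k) * (1 / (2 * real k)))"
      by (rule powr_power)
    also have "of_nat (2 * k) * (1 / (2 * real k)) = 1" using k by simp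
    finally show ?thesis using B0 by simp
  qed (use k in simp)
  then have "Q ^ (2 * k) \<le> (M * real Y * real U * real V * B powr (1 / (2 * real k))) ^ (2 * k)"
    using le by (simp only: power_mult_distrib)
  then have Q: "Q \<le> M * real Y * real U * real V * B powr (1 / (2 * real k))"
    using k M Q0 by (subst (asm) power_mono_iff) auto
  have "real U * real V * (\<Sum>a\<in>D. cmod (kl_sum p Y a)) =
      (\<Sum>a\<in>D. real U * real V * cmod (kl_sum p Y a))"
    by (simp add: sum_distrib_left)
  also have "\<dots> \<le> (\<Sum>a\<in>D. (\<Sum>u\<in>{U<..2*U}. \<Sum>y\<in>{1..Y}.
       cmod (recip_sum p V (a * int u ^ (p - 2) mod int p) (int y * int u ^ (p - 2) mod int p)))
    + real U * real V * (4 * real U * real V))"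
    by (intro sum_mono norm_kl_sum_le_shifts p)
  also have "\<dots> = Q + M * (real U * real V * (4 * real U * real V))"
    by (simp add: sum.distrib Q_def X_def h_def \<phi>_def sum.cartesian_product M_def case_prod_beta)
  also have "\<dots> \<le> M * real Y * real U * real V * B powr (1 / (2 * real k)) + M * (real U * real V * (4 * real U * real V))"
    using Q by simp
  also have "\<dots> = real U * real V * (M * real Y * B powr (1 / (2 * real k)) + 4 * M * real U * real V)"
    by (simp add: algebra_simps)
  finally show ?thesis using pos by (simp add: B_def)
qed

section \<open>Exponential sums at reciprocals\<close>

text \<open>Serves for the weighted sum over the given set and, with all weights 1, for the sum over
  the interval.\<close>

definition exp_sum :: "nat \<Rightarrow> int set \<Rightarrow> (int \<Rightarrow> complex) \<Rightarrow> int \<Rightarrow> complex" where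
  "exp_sum p S \<alpha> x = (\<Sum>m\<in>S. \<alpha> m * ep p (m * x))"

text \<open>Opening the square makes the sum over \<open>y\<close> innermost, where it is an
  incomplete Kloosterman sum at \<open>m - n\<close>; the weights are then removed by absolute
  values.\<close>

lemma exp_sum_reciprocals_second_moment:
  assumes S: "finite S" and \<alpha>: "\<And>m. m \<in> S \<Longrightarrow> cmod (\<alpha> m) \<le> A"
  shows "(\<Sum>y\<in>{1..Y}. (cmod (exp_sum p S \<alpha> (int y ^ (p - 2))))\<^sup>2) \<le>
    A\<^sup>2 * (\<Sum>n\<in>S. \<Sum>m\<in>S. cmod (kl_sum p Y (m - n)))"
proof -
  have expand: "of_real ((cmod (exp_sum p S \<alpha> x))\<^sup>2) =
      (\<Sum>n\<in>S. \<Sum>m\<in>S. \<alpha> m * cnj (\<alpha> n) * ep p ((m - n) * x))" for x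
  proof -
    have "of_real ((cmod (exp_sum p S \<alpha> x))\<^sup>2) = exp_sum p S \<alpha> x * cnj (exp_sum p S \<alpha> x)"
      by (rule complex_norm_square)
    also have "\<dots> = (\<Sum>m\<in>S. \<Sum>n\<in>S. (\<alpha> m * ep p (m * x)) * (cnj (\<alpha> n) * ep p (- (n * x))))"
      by (simp add: exp_sum_def sum_product ep_minus)
    also have "\<dots> = (\<Sum>m\<in>S. \<Sum>n\<in>S. \<alpha> m * cnj (\<alpha> n) * ep p ((m - n) * x))"
    proof (intro sum.cong refl)
      fix m n
      have "(m - n) * x = m * x + - (n * x)" by (simp add: algebra_simps)
      then show "(\<alpha> m * ep p (m * x)) * (cnj (\<alpha> n) * ep p (- (n * x))) =
          \<alpha> m * cnj (\<alpha> n) * ep p ((m - n) * x)"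
        by (simp only: ep_add mult_ac)
    qed
    finally show ?thesis by (subst sum.swap)
  qed
  have "complex_of_real (\<Sum>y\<in>{1..Y}. (cmod (exp_sum p S \<alpha> (int y ^ (p - 2))))\<^sup>2) =
      (\<Sum>y\<in>{1..Y}. \<Sum>n\<in>S. \<Sum>m\<in>S. \<alpha> m * cnj (\<alpha> n) * ep p ((m - n) * int y ^ (p - 2)))"
    by (simp only: of_real_sum expand)
  also have "\<dots> = (\<Sum>n\<in>S. \<Sum>m\<in>S. \<Sum>y\<in>{1..Y}. \<alpha> m * cnj (\<alpha> n) * ep p ((m - n) * int y ^ (p - 2)))"
    by (subst sum.swap, subst (2) sum.swap) (rule refl)
  also have "\<dots> = (\<Sum>n\<in>S. \<Sum>m\<in>S. \<alpha> m * cnj (\<alpha> n) * kl_sum p Y (m - n))"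
    by (simp only: kl_sum_def sum_distrib_left)
  finally have eq: "complex_of_real (\<Sum>y\<in>{1..Y}. (cmod (exp_sum p S \<alpha> (int y ^ (p - 2))))\<^sup>2) =
      (\<Sum>n\<in>S. \<Sum>m\<in>S. \<alpha> m * cnj (\<alpha> n) * kl_sum p Y (m - n))" .
  have "(\<Sum>y\<in>{1..Y}. (cmod (exp_sum p S \<alpha> (int y ^ (p - 2))))\<^sup>2) =
      cmod (complex_of_real (\<Sum>y\<in>{1..Y}. (cmod (exp_sum p S \<alpha> (int y ^ (p - 2))))\<^sup>2))"
    by (simp only: norm_of_real) (intro abs_of_nonneg[symmetric] sum_nonneg, simp)
  also have "\<dots> = cmod (\<Sum>n\<in>S. \<Sum>m\<in>S. \<alpha> m * cnj (\<alpha> n) * kl_sum p Y (m - n))"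
    by (simp only: eq)
  also have "\<dots> \<le> (\<Sum>n\<in>S. \<Sum>m\<in>S. A\<^sup>2 * cmod (kl_sum p Y (m - n)))"
  proof (intro sum_norm_le)
    fix m n assume mn: "m \<in> S" "n \<in> S"
    have "0 \<le> A" using \<alpha>[OF mn(1)] norm_ge_zero order_trans by blast
    then have "cmod (\<alpha> m) * cmod (\<alpha> n) \<le> A * A" using mn \<alpha> by (intro mult_mono) auto
    then have "cmod (\<alpha> m) * cmod (\<alpha> n) * cmod (kl_sum p Y (m - n)) \<le> A\<^sup>2 * cmod (kl_sum p Y (m - n))"
      unfolding power2_eq_square by (rule mult_right_mono) simp
    then show "cmod (\<alpha> m * cnj (\<alpha> n) * kl_sum p Y (m - n)) \<le> A\<^sup>2 * cmod (kl_sum p Y (m - n))"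
      by (simp add: norm_mult)
  qed
  also have "\<dots> = A\<^sup>2 * (\<Sum>n\<in>S. \<Sum>m\<in>S. cmod (kl_sum p Y (m - n)))"
    by (simp add: sum_distrib_left)
  finally show ?thesis .
qed

text \<open>Cauchy-Schwarz in \<open>y\<close>, then the second moment. For fixed \<open>n\<close>
  the differences \<open>m - n\<close> form a translate of \<open>S\<close>, which may leave
  \<open>{0..<int p}\<close>; this is why \<open>W\<close> is assumed for sets \<open>D\<close> with
  distinct residues instead of sets of residues.\<close>

lemma sum_exp_sum_reciprocals_le:
  assumes S: "finite S" "S \<subseteq> {0..<int p}" and \<alpha>: "\<And>m. m \<in> S \<Longrightarrow> cmod (\<alpha> m) \<le> A"
    and W: "\<And>D. finite D \<Longrightarrow> D \<noteq> {} \<Longrightarrow> inj_on (\<lambda>a. a mod int p) D \<Longrightarrow> card D = card S \<Longrightarrow>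
       (\<Sum>a\<in>D. cmod (kl_sum p Y a)) \<le> W"
  shows "(\<Sum>y\<in>{1..Y}. cmod (exp_sum p S \<alpha> (int y ^ (p - 2))))\<^sup>2 \<le> real Y * (A\<^sup>2 * (real (card S) * W))"
proof -
  have "(\<Sum>y\<in>{1..Y}. cmod (exp_sum p S \<alpha> (int y ^ (p - 2))))\<^sup>2 \<le>
      (\<Sum>y\<in>{1..Y}. (cmod (exp_sum p S \<alpha> (int y ^ (p - 2))))\<^sup>2) * real Y"
    using sum_squared_le_sum_of_squares[of "\<lambda>y. cmod (exp_sum p S \<alpha> (int y ^ (p - 2)))" "{1..Y}"] by simp
  also have "\<dots> \<le> (A\<^sup>2 * (\<Sum>n\<in>S. \<Sum>m\<in>S. cmod (kl_sum p Y (m - n)))) * real Y"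
    by (intro mult_right_mono exp_sum_reciprocals_second_moment S(1) \<alpha>) auto
  also have "\<dots> \<le> (A\<^sup>2 * (\<Sum>n\<in>S. W)) * real Y"
  proof (intro mult_right_mono mult_left_mono sum_mono)
    fix n assume n: "n \<in> S"
    have inj: "inj_on (\<lambda>m. m - n) S" by (auto simp: inj_on_def)
    have "(\<Sum>m\<in>S. cmod (kl_sum p Y (m - n))) = (\<Sum>a\<in>(\<lambda>m. m - n) ` S. cmod (kl_sum p Y a))"
      by (simp add: sum.reindex[OF inj])
    also have "\<dots> \<le> W"
    proof (rule W)
      show "inj_on (\<lambda>a. a mod int p) ((\<lambda>m. m - n) ` S)"
      proof (rule inj_onI, elim imageE)
        fix a b x y assume ab: "a mod int p = b mod int p" "a = x - n" "x \<in> S" "b = y - n" "y \<in> S"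
        then have "[x - n = y - n] (mod int p)" by (simp add: cong_def)
        then have "[(x - n) + n = (y - n) + n] (mod int p)" by (rule cong_add) simp
        then have "[x = y] (mod int p)" by simp
        then have "x = y" using ab S(2) by (auto simp: cong_def subset_iff)
        then show "a = b" using ab by simp
      qed
      show "(\<lambda>m. m - n) ` S \<noteq> {}" using n by blast
    qed (use S(1) inj in \<open>auto simp: card_image\<close>)
    finally show "(\<Sum>m\<in>S. cmod (kl_sum p Y (m - n))) \<le> W" .
  qed auto
  also have "\<dots> = real Y * (A\<^sup>2 * (real (card S) * W))" by simp
  finally show ?thesis .
qed

section \<open>Harmonic numbers, floors and the choice of parameters\<close>

lemma harm_le_ln: "n \<ge> 1 \<Longrightarrow> harm n \<le> 1 + ln (real n)"
proof -
  assume "n \<ge> 1"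
  then obtain m where m: "n = Suc m" by (metis Suc_le_D One_nat_def)
  have "harm (Suc m) - ln (real (Suc m)) \<le> harm (Suc 0) - ln (real (Suc 0))"
    using decseq_harm_diff_ln by (rule decseqD) simp
  then show ?thesis by (simp add: m harm_def)
qed

lemma harm_le_powr:
  assumes "n \<ge> 1" "a > 0"
  shows "harm n \<le> (1 + 1 / a) * real n powr a"
proof -
  have "harm n \<le> 1 + ln (real n)" using assms by (intro harm_le_ln)
  also have "\<dots> \<le> real n powr a + real n powr a / a"
    using assms by (intro add_mono ln_powr_bound ge_one_powr_ge_zero) auto
  finally show ?thesis by (simp add: algebra_simps)
qed

lemma nat_floor_bounds:
  fixes x :: real
  assumes "x \<ge> 1"
  shows "1 \<le> nat \<lfloor>x\<rfloor>" "real (nat \<lfloor>x\<rfloor>) \<le> x" "x / 2 \<le> real (nat \<lfloor>x\<rfloor>)"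
proof -
  have "\<lfloor>x\<rfloor> \<ge> 1" using assms by simp
  then have "real (nat \<lfloor>x\<rfloor>) = of_int \<lfloor>x\<rfloor>" by simp
  then show "1 \<le> nat \<lfloor>x\<rfloor>" "real (nat \<lfloor>x\<rfloor>) \<le> x" "x / 2 \<le> real (nat \<lfloor>x\<rfloor>)"
    using assms \<open>\<lfloor>x\<rfloor> \<ge> 1\<close> by linarith+
qed

text \<open>With \<open>\<tau> = 1 / k\<close>, the collision factor is of order at most
  \<open>P powr (- 2 * \<tau>)\<close> and the moment factor is bounded. The root of order
  \<open>2 * k\<close> leaves a saving of \<open>\<tau>\<close> squared for the Kloosterman sums,
  and Cauchy-Schwarz halves it.\<close>

lemma exp_sum_reciprocals_power_saving:
  fixes \<epsilon> :: real
  assumes \<epsilon>: "0 < \<epsilon>" "\<epsilon> \<le> 1"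
  obtains \<kappa> C :: real where "\<kappa> > 0" "C > 0"
    "\<And>p S \<alpha> A Y. prime p \<Longrightarrow> p \<ge> 5 \<Longrightarrow> S \<subseteq> {0..<int p} \<Longrightarrow> real (card S) > real p powr \<epsilon> \<Longrightarrow>
       (\<And>m. m \<in> S \<Longrightarrow> cmod (\<alpha> m) \<le> A) \<Longrightarrow> real Y \<ge> sqrt (real p) \<Longrightarrow>
       (\<Sum>y\<in>{1..Y}. cmod (exp_sum p S \<alpha> (int y ^ (p - 2)))) \<le>
         C * A * real (card S) * real Y * real p powr (- \<kappa>)"
proof -
  \<comment> \<open>Large enough that \<open>8 * \<tau> \<le> \<epsilon>\<close>, which leaves room
    for all losses of a few multiples of \<open>\<tau>\<close> in the exponent.\<close>
  define k where "k = nat \<lceil>8 / \<epsilon>\<rceil>"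
  define \<tau> where "\<tau> = 1 / real k"
  have k8: "8 / \<epsilon> \<le> real k" unfolding k_def by (rule real_nat_ceiling_ge)
  have "8 \<le> 8 / \<epsilon>" using \<epsilon> by (simp add: field_simps)
  then have k: "k \<ge> 8" using k8 by linarith
  have \<tau>: "\<tau> > 0" "\<tau> \<le> 1 / 8" "8 * \<tau> \<le> \<epsilon>"
    using k k8 \<epsilon> by (auto simp: \<tau>_def field_simps)
  define C1 where "C1 = (24 + 16 * real k) * (2 ^ k * real k ^ (2 * k) + 4 * real k)"
  have C1: "C1 \<ge> 1"
  proof -
    have "1 * 1 \<le> C1" unfolding C1_def using k by (intro mult_mono) (auto intro: add_increasing)
    then show ?thesis by simp
  qed
  show thesis
  proof (rule that)
    show "\<tau>\<^sup>2 / 2 > 0" using \<tau> by simp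
    show "C1 + 4 > 0" using C1 by simp
    fix p S \<alpha> A Y
    assume p: "prime p" "p \<ge> 5" and S: "S \<subseteq> {0..<int p}" "real (card S) > real p powr \<epsilon>"
      and \<alpha>: "\<And>m. m \<in> S \<Longrightarrow> cmod (\<alpha> m) \<le> A" and Y: "real Y \<ge> sqrt (real p)"
    define P where "P = real p"
    define M where "M = real (card S)"
    \<comment> \<open>\<open>V ^ k\<close> has order \<open>P\<close>, so the diagonal part of the
      moment no longer dominates. \<open>U * V\<close> stays below the square root of
      \<open>P\<close>, and hence below \<open>Y\<close>, by a factor \<open>P powr \<tau>\<close>,
      so shifting is cheap.\<close>
    define U where "U = nat \<lfloor>P powr (1 / 2 - 2 * \<tau>)\<rfloor>"
    define V where "V = nat \<lfloor>P powr \<tau>\<rfloor>"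
    have P: "P \<ge> 5" using p by (simp add: P_def)
    have finS: "finite S" using S(1) finite_subset by blast
    have M: "M > P powr \<epsilon>" using S by (simp add: M_def P_def)
    have M0: "M > 0" using M by (rule le_less_trans[rotated]) simp
    have Sne: "S \<noteq> {}" using M0 by (auto simp: M_def)
    obtain m0 where "m0 \<in> S" using Sne by blast
    then have A0: "A \<ge> 0" using \<alpha> norm_ge_zero order_trans by blast
    have mono: "P powr a \<le> P powr b" if "a \<le> b" for a b using that P by (intro powr_mono) auto
    have ge1: "1 \<le> P powr a" if "a \<ge> 0" for a using that P by (intro ge_one_powr_ge_zero) auto
    have Yp: "real Y \<ge> P powr (1 / 2)" using Y P by (simp add: P_def powr_half_sqrt)
    have Vb: "1 \<le> V" "real V \<le> P powr \<tau>" "P powr \<tau> / 2 \<le> real V"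
      unfolding V_def using \<tau> by (intro nat_floor_bounds ge1; linarith)+
    have Ub: "1 \<le> U" "real U \<le> P powr (1 / 2 - 2 * \<tau>)" "P powr (1 / 2 - 2 * \<tau>) / 2 \<le> real U"
      unfolding U_def using \<tau> by (intro nat_floor_bounds ge1; linarith)+
    have Uhalf: "real U \<le> P powr (1 / 2)" using Ub(2) mono[of "1/2 - 2 * \<tau>" "1/2"] \<tau> by linarith
    have "2 * P powr (1 / 2) < P"
    proof -
      have "2 < sqrt P" using P by (intro real_less_rsqrt) auto
      then have "2 * sqrt P < sqrt P * sqrt P" using P by (intro mult_strict_right_mono) auto
      then show ?thesis using P by (simp add: powr_half_sqrt)
    qed
    then have Up: "2 * U < p" using Uhalf by (simp add: P_def flip: of_nat_less_iff)
    have "P powr \<tau> < P powr 1" using \<tau> P by (intro powr_less_mono) auto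
    then have Vp: "V < p" using Vb(2) P by (simp add: P_def flip: of_nat_less_iff)
    have UY: "U \<le> Y" using Uhalf Yp by (simp flip: of_nat_le_iff)
    have U0: "real U > 0" and V0: "real V > 0" and Y0: "real Y > 0" using Ub(1) Vb(1) UY by auto
    define B where "B = (8 / M + 8 * P * harm (2 * U) / (M * real Y * real U)) *
       (P * real k ^ (2 * k) / real V ^ k + 4 * real k)"
    define W where "W = M * real Y * B powr (1 / (2 * real k)) + 4 * M * real U * real V"
    \<comment> \<open>The harmonic number is charged to \<open>P powr \<tau>\<close>; the constant
      is \<open>1 + 1 / \<tau>\<close>.\<close>
    have H: "harm (2 * U) \<le> (1 + real k) * P powr \<tau>"
    proof -
      have "harm (2 * U) \<le> (harm p :: real)" using Up by (intro harm_mono) simp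
      also have "\<dots> \<le> (1 + 1 / \<tau>) * real p powr \<tau>" using p \<tau> by (intro harm_le_powr) auto
      finally show ?thesis by (simp add: \<tau>_def P_def)
    qed
    have B1: "8 / M + 8 * P * harm (2 * U) / (M * real Y * real U) \<le> (24 + 16 * real k) * P powr (- 2 * \<tau>)"
    proof -
      have "8 / M \<le> 8 / P powr \<epsilon>" using M M0 P by (intro divide_left_mono mult_pos_pos) auto
      also have "\<dots> = 8 * P powr (- \<epsilon>)" by (simp add: powr_minus divide_inverse)
      also have "\<dots> \<le> 8 * P powr (- 2 * \<tau>)" using \<tau> by (intro mult_left_mono mono) auto
      finally have 1: "8 / M \<le> 8 * P powr (- 2 * \<tau>)" .
      have "P powr \<epsilon> * P powr (1 / 2) * (P powr (1 / 2 - 2 * \<tau>) / 2) \<le> M * real Y * real U"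
        using M Yp Ub M0 Y0 by (intro mult_mono) auto
      also have "P powr \<epsilon> * P powr (1 / 2) * (P powr (1 / 2 - 2 * \<tau>) / 2) = P powr (1 + \<epsilon> - 2 * \<tau>) / 2"
        by (simp add: powr_add[symmetric] algebra_simps)
      finally have den: "P powr (1 + \<epsilon> - 2 * \<tau>) / 2 \<le> M * real Y * real U" .
      have "8 * P * harm (2 * U) / (M * real Y * real U) \<le>
          8 * P * ((1 + real k) * P powr \<tau>) / (P powr (1 + \<epsilon> - 2 * \<tau>) / 2)"
        using H den P by (intro frac_le mult_left_mono) (auto simp: harm_nonneg)
      also have "\<dots> = 16 * (1 + real k) * (P powr 1 * P powr \<tau> / P powr (1 + \<epsilon> - 2 * \<tau>))"
        using P by simp
      also have "P powr 1 * P powr \<tau> / P powr (1 + \<epsilon> - 2 * \<tau>) = P powr (3 * \<tau> - \<epsilon>)"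
      proof -
        have "3 * \<tau> - \<epsilon> = 1 + \<tau> - (1 + \<epsilon> - 2 * \<tau>)" by simp
        then show ?thesis by (simp only: powr_add powr_diff)
      qed
      also have "16 * (1 + real k) * P powr (3 * \<tau> - \<epsilon>) \<le> 16 * (1 + real k) * P powr (- 2 * \<tau>)"
        using \<tau> by (intro mult_left_mono mono) auto
      finally show ?thesis using 1 by (simp add: algebra_simps)
    qed
    have B2: "P * real k ^ (2 * k) / real V ^ k + 4 * real k \<le> 2 ^ k * real k ^ (2 * k) + 4 * real k"
    proof -
      \<comment> \<open>Uses \<open>k * \<tau> = 1\<close>; the floor in \<open>V\<close> costs at
        most a factor 2 in each of the \<open>k\<close> factors.\<close>
      have "P / 2 ^ k = (P powr \<tau> / 2) ^ k"
      proof -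
        have "(P powr \<tau>) ^ k = P powr (real k * \<tau>)" using P by (intro powr_power) simp
        also have "real k * \<tau> = 1" using k by (simp add: \<tau>_def)
        finally show ?thesis using P by (simp add: power_divide)
      qed
      also have "\<dots> \<le> real V ^ k" using Vb by (intro power_mono) auto
      finally have "P \<le> 2 ^ k * real V ^ k" by (simp add: field_simps)
      then have "P * real k ^ (2 * k) \<le> 2 ^ k * real V ^ k * real k ^ (2 * k)" by (rule mult_right_mono) simp
      then show ?thesis using V0 by (simp add: pos_divide_le_eq mult_ac)
    qed
    have B0: "B \<ge> 0" unfolding B_def using M0 P
      by (intro mult_nonneg_nonneg add_nonneg_nonneg divide_nonneg_nonneg) (auto simp: harm_nonneg)
    have B: "B \<le> C1 * P powr (- 2 * \<tau>)"
    proof -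
      have "B \<le> ((24 + 16 * real k) * P powr (- 2 * \<tau>)) * (2 ^ k * real k ^ (2 * k) + 4 * real k)"
        unfolding B_def using P by (intro mult_mono B1 B2) auto
      then show ?thesis by (simp add: C1_def mult_ac)
    qed
    have "B powr (1 / (2 * real k)) \<le> (C1 * P powr (- 2 * \<tau>)) powr (1 / (2 * real k))"
      using B B0 by (intro powr_mono2) auto
    also have "\<dots> = C1 powr (1 / (2 * real k)) * P powr (- (\<tau>\<^sup>2))"
      using C1 k by (simp add: powr_mult powr_powr \<tau>_def power2_eq_square)
    also have "\<dots> \<le> C1 powr 1 * P powr (- (\<tau>\<^sup>2))"
      using C1 k by (intro mult_right_mono powr_mono) auto
    finally have Bk: "B powr (1 / (2 * real k)) \<le> C1 * P powr (- (\<tau>\<^sup>2))" using C1 by simp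
    have UV: "real U * real V \<le> real Y * P powr (- (\<tau>\<^sup>2))"
    proof -
      have "real U * real V \<le> P powr (1 / 2 - 2 * \<tau>) * P powr \<tau>" using Ub Vb by (intro mult_mono) auto
      also have "\<dots> = P powr (1 / 2) * P powr (- \<tau>)" by (simp add: powr_add[symmetric])
      also have "\<dots> \<le> real Y * P powr (- (\<tau>\<^sup>2))"
      proof (intro mult_mono Yp mono)
        have "\<tau> * \<tau> \<le> \<tau> * 1" using \<tau> by (intro mult_left_mono) auto
        then show "- \<tau> \<le> - (\<tau>\<^sup>2)" by (simp add: power2_eq_square)
      qed auto
      finally show ?thesis .
    qed
    have W: "W \<le> (C1 + 4) * (M * real Y * P powr (- (\<tau>\<^sup>2)))"
    proof -
      have "M * real Y * B powr (1 / (2 * real k)) \<le> M * real Y * (C1 * P powr (- (\<tau>\<^sup>2)))"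
        using M0 Y0 by (intro mult_left_mono Bk) auto
      moreover have "4 * M * (real U * real V) \<le> 4 * M * (real Y * P powr (- (\<tau>\<^sup>2)))"
        using M0 by (intro mult_left_mono UV) auto
      ultimately show ?thesis unfolding W_def by (simp add: algebra_simps)
    qed
    let ?T = "\<Sum>y\<in>{1..Y}. cmod (exp_sum p S \<alpha> (int y ^ (p - 2)))"
    have "?T\<^sup>2 \<le> real Y * (A\<^sup>2 * (real (card S) * W))"
    proof (rule sum_exp_sum_reciprocals_le[OF finS S(1) \<alpha>])
      fix D :: "int set" assume D: "finite D" "D \<noteq> {}" "inj_on (\<lambda>a. a mod int p) D" "card D = card S"
      show "(\<Sum>a\<in>D. cmod (kl_sum p Y a)) \<le> W"
        using sum_norm_kl_sum_le[OF p(1) _ Up Vb(1) Vp Ub(1) UY D(1-3), of k] p(2) k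
        by (simp add: W_def B_def D(4) M_def P_def)
    qed
    also have "\<dots> \<le> real Y * (A\<^sup>2 * (M * ((C1 + 4) * (M * real Y * P powr (- (\<tau>\<^sup>2))))))"
      unfolding M_def[symmetric] using M0 by (intro mult_left_mono W) auto
    also have "\<dots> = (C1 + 4) * (A * M * real Y * P powr (- (\<tau>\<^sup>2 / 2)))\<^sup>2"
    proof -
      have "P powr (- (\<tau>\<^sup>2)) = (P powr (- (\<tau>\<^sup>2 / 2)))\<^sup>2"
        using P by (simp add: powr_power)
      then show ?thesis by (simp only: power_mult_distrib) (simp add: power2_eq_square mult_ac)
    qed
    \<comment> \<open>The constant is enlarged to a square so that the root can be taken of the
      whole bound.\<close>
    also have "\<dots> \<le> (C1 + 4)\<^sup>2 * (A * M * real Y * P powr (- (\<tau>\<^sup>2 / 2)))\<^sup>2"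
    proof (rule mult_right_mono)
      have "(C1 + 4) * 1 \<le> (C1 + 4) * (C1 + 4)" using C1 by (intro mult_left_mono) auto
      then show "C1 + 4 \<le> (C1 + 4)\<^sup>2" by (simp add: power2_eq_square)
    qed simp
    finally have "?T\<^sup>2 \<le> ((C1 + 4) * (A * M * real Y * P powr (- (\<tau>\<^sup>2 / 2))))\<^sup>2"
      by (simp only: power_mult_distrib)
    then have "?T \<le> (C1 + 4) * (A * M * real Y * P powr (- (\<tau>\<^sup>2 / 2)))"
      using C1 A0 M0 by (elim power2_le_imp_le) auto
    then show "?T \<le> (C1 + 4) * A * real (card S) * real Y * real p powr (- (\<tau>\<^sup>2 / 2))"
      by (simp add: M_def P_def mult_ac)
  qed
qed

section \<open>Bilinear sums with Kloosterman sums\<close>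

text \<open>Partial summation against a decreasing \<open>g\<close>. The constant part
  \<open>r\<close> of the bound on partial sums meets only \<open>g 1\<close>, and the linear part
  reproduces the sum of \<open>g\<close>.\<close>

lemma abel_sum_le:
  fixes g G :: "nat \<Rightarrow> real"
  assumes g: "\<And>y. 1 \<le> y \<Longrightarrow> g (Suc y) \<le> g y"
    and G: "\<And>Y. (\<Sum>y\<in>{1..Y}. G y) \<le> c * (r + real Y)"
    and h: "1 \<le> h" and gh: "g h \<ge> 0"
  shows "(\<Sum>y\<in>{1..h}. g y * G y) \<le> c * (r * g 1 + (\<Sum>y\<in>{1..h}. g y))"
proof -
  \<comment> \<open>The induction carries the boundary term, \<open>g h\<close> times the slack in
    the bound for the partial sum; it is nonnegative and dropped at the end.\<close>
  have "(\<Sum>y\<in>{1..h}. g y * G y) + g h * (c * (r + real h) - (\<Sum>y\<in>{1..h}. G y)) \<le>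
      c * (r * g 1 + (\<Sum>y\<in>{1..h}. g y))"
    using h
  proof (induction h rule: dec_induct)
    case base
    then show ?case by (simp add: algebra_simps)
  next
    case (step h)
    define t where "t = c * (r + real h) - (\<Sum>y\<in>{1..h}. G y)"
    have "(g (Suc h) - g h) * t \<le> 0"
      using g[OF step(1)] G[of h] by (intro mult_nonpos_nonneg) (auto simp: t_def)
    moreover have "(\<Sum>y\<in>{1..Suc h}. g y * G y) + g (Suc h) * (c * (r + real (Suc h)) - (\<Sum>y\<in>{1..Suc h}. G y)) =
        ((\<Sum>y\<in>{1..h}. g y * G y) + g h * t) + (g (Suc h) - g h) * t + c * g (Suc h)"
      by (simp add: t_def algebra_simps)
    ultimately show ?case
      using step.IH by (simp add: t_def algebra_simps)
  qed
  moreover have "0 \<le> g h * (c * (r + real h) - (\<Sum>y\<in>{1..h}. G y))"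
    using gh G[of h] by simp
  ultimately show ?thesis by linarith
qed

text \<open>A weak form of Jordan's inequality. Up to \<open>pi / 3\<close> the mean value theorem
  applies with cosine at least 1/2; beyond that, monotonicity of sine suffices.\<close>

lemma sin_ge_linear:
  fixes x :: real
  assumes "0 \<le> x" "x \<le> pi / 2"
  shows "x / pi \<le> sin x"
proof (cases "x \<le> pi / 3")
  case True
  show ?thesis
  proof (cases "x = 0")
    case False
    then have x: "0 < x" using assms by simp
    obtain z where z: "0 < z" "z < x" "sin x - sin 0 = (x - 0) * cos z"
      using MVT2[OF x, of sin cos] by (auto intro: DERIV_sin)
    have "cos (pi / 3) \<le> cos z"
      using z True by (intro cos_monotone_0_pi_le) auto
    moreover have "1 / pi \<le> 1 / 2" using pi_gt3 by (intro divide_left_mono) auto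
    ultimately have "1 / pi \<le> cos z" by (simp only: cos_60)
    then have "x * (1 / pi) \<le> x * cos z" using x by (intro mult_left_mono) auto
    then show ?thesis using z by simp
  qed simp
next
  case False
  have "sin (pi / 3) \<le> sin x"
    using False assms by (intro sin_monotone_2pi_le) auto
  moreover have "1 \<le> sqrt 3" by simp
  moreover have "x / pi \<le> 1 / 2" using assms by (simp add: field_simps)
  ultimately show ?thesis unfolding sin_60 by linarith
qed

text \<open>The chord length is \<open>2 * sin x\<close> with \<open>x = pi * y / p\<close>, and
  \<open>2 * y \<le> p\<close> keeps \<open>x\<close> in the range of the linear bound.\<close>

lemma norm_ep_minus_1_ge:
  assumes "1 \<le> y" "2 * y \<le> p"
  shows "2 * real y / real p \<le> cmod (ep p (int y) - 1)"
proof -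
  define x where "x = pi * real y / real p"
  have x: "0 \<le> x" "x \<le> pi / 2" using assms by (auto simp: x_def field_simps)
  have "2 * pi * real_of_int (int y) / real p = 2 * x" by (simp add: x_def)
  then have "ep p (int y) = cis (2 * x)" by (simp only: ep_def)
  then have "(cmod (ep p (int y) - 1))\<^sup>2 = (cos (2 * x) - 1)\<^sup>2 + (sin (2 * x))\<^sup>2"
    by (simp add: cmod_power2)
  also have "\<dots> = 2 * (1 - cos (2 * x))"
    by (simp add: sin_squared_eq power2_diff)
  also have "\<dots> = (2 * sin x)\<^sup>2" by (simp add: cos_double_sin power_mult_distrib)
  finally have sq: "(cmod (ep p (int y) - 1))\<^sup>2 = (2 * sin x)\<^sup>2" .
  have sin: "x / pi \<le> sin x" by (rule sin_ge_linear[OF x])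
  moreover have "0 \<le> x / pi" using x by simp
  ultimately have "0 \<le> 2 * sin x" by linarith
  then have "cmod (ep p (int y) - 1) = 2 * sin x"
    using sq power2_eq_iff_nonneg[of "cmod (ep p (int y) - 1)" "2 * sin x"] by simp
  moreover have "x / pi = real y / real p" by (simp add: x_def)
  ultimately show ?thesis using sin by simp
qed

section \<open>Exponential sums over intervals of residues\<close>

lemma exp_sum_cong:
  assumes "p > 0" "[x = y] (mod int p)"
  shows "exp_sum p S \<alpha> x = exp_sum p S \<alpha> y"
  unfolding exp_sum_def
proof (rule sum.cong[OF refl])
  fix m
  have "ep p (m * x) = ep p (m * y)"
    by (rule ep_cong[OF assms(1) cong_mult[OF cong_refl assms(2)]])
  then show "\<alpha> m * ep p (m * x) = \<alpha> m * ep p (m * y)" by simp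
qed

lemma exp_sum_minus: "exp_sum p S \<alpha> (- x) = cnj (exp_sum p S (\<lambda>m. cnj (\<alpha> m)) x)"
  by (simp add: exp_sum_def ep_minus)

lemma inj_on_mod_consecutive:
  assumes "N \<le> p"
  shows "inj_on (\<lambda>k. k mod int p) {N0 + 1..N0 + int N}"
proof (rule inj_onI)
  fix k l assume kl: "k \<in> {N0 + 1..N0 + int N}" "l \<in> {N0 + 1..N0 + int N}" "k mod int p = l mod int p"
  then have "int p dvd k - l" by (simp add: mod_eq_dvd_iff)
  moreover have "\<bar>k - l\<bar> < int p" using kl assms by auto
  ultimately show "k = l" using dvd_imp_le_int[of "k - l" "int p"] by fastforce
qed

text \<open>Any \<open>p\<close> consecutive integers contain a multiple of \<open>p\<close>,
  whereas \<open>J\<close> avoids 0. Hence reduction is injective on the underlying integers, and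
  \<open>J\<close> really has \<open>N\<close> elements.\<close>

lemma Fp_interval_length_less:
  assumes "p > 0" "Fp_interval p N J" "J \<subseteq> Fp_star p"
  shows "N < p"
proof (rule ccontr)
  assume N: "\<not> N < p"
  obtain N0 where J: "J = (\<lambda>k. k mod int p) ` {N0 + 1..N0 + int N}"
    using assms(2) by (auto simp: Fp_interval_def)
  \<comment> \<open>The least multiple of \<open>p\<close> that is at least
    \<open>N0 + 1\<close>.\<close>
  define k where "k = N0 + 1 + (- (N0 + 1)) mod int p"
  have "0 \<le> (- (N0 + 1)) mod int p" "(- (N0 + 1)) mod int p < int p" using assms(1) by simp_all
  then have "k \<in> {N0 + 1..N0 + int N}" using N by (simp add: k_def)
  moreover have "k mod int p = 0"
  proof -
    have "k mod int p = (N0 + 1 + (- (N0 + 1))) mod int p" unfolding k_def by (rule mod_add_right_eq)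
    then show ?thesis by simp
  qed
  ultimately have "0 \<in> J" unfolding J by (metis imageI)
  then show False using assms(3) by (auto simp: Fp_star_def)
qed

text \<open>Periodicity of the character undoes the reduction modulo \<open>p\<close>, also for
  intervals that wrap around, and leaves a geometric series with ratio
  \<open>ep p y\<close>.\<close>

lemma exp_sum_interval_bounds:
  assumes p: "p > 0" and J: "Fp_interval p N J" "J \<subseteq> Fp_star p"
  shows "cmod (exp_sum p J (\<lambda>_. 1) x) \<le> real N"
    and "1 \<le> y \<Longrightarrow> 2 * y \<le> p \<Longrightarrow> cmod (exp_sum p J (\<lambda>_. 1) (int y)) \<le> real p / real y"
proof -
  obtain N0 where J': "J = (\<lambda>k. k mod int p) ` {N0 + 1..N0 + int N}"
    using J(1) by (auto simp: Fp_interval_def)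
  have "N < p" by (rule Fp_interval_length_less[OF p J])
  then have inj: "inj_on (\<lambda>k. k mod int p) {N0 + 1..N0 + int N}"
    by (intro inj_on_mod_consecutive) simp
  have eq: "exp_sum p J (\<lambda>_. 1) x = (\<Sum>j<N. ep p ((N0 + 1 + int j) * x))" for x
  proof -
    have "exp_sum p J (\<lambda>_. 1) x = (\<Sum>k\<in>{N0 + 1..N0 + int N}. ep p ((k mod int p) * x))"
      unfolding exp_sum_def J' by (subst sum.reindex[OF inj]) simp
    also have "\<dots> = (\<Sum>k\<in>{N0 + 1..N0 + int N}. ep p (k * x))"
      by (intro sum.cong refl ep_cong p cong_mult) (simp_all add: cong_def)
    also have "\<dots> = (\<Sum>j<N. ep p ((N0 + 1 + int j) * x))"
      by (rule sum.reindex_bij_witness[of _ "\<lambda>j. N0 + 1 + int j" "\<lambda>k. nat (k - N0 - 1)"]) auto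
    finally show ?thesis .
  qed
  show "cmod (exp_sum p J (\<lambda>_. 1) x) \<le> real N"
    unfolding eq by (rule order_trans[OF norm_sum]) simp
  assume y: "1 \<le> y" "2 * y \<le> p"
  define z where "z = ep p (int y)"
  have ge: "2 * real y / real p \<le> cmod (z - 1)" unfolding z_def by (rule norm_ep_minus_1_ge[OF y])
  moreover have "0 < 2 * real y / real p" using y p by simp
  ultimately have "0 < cmod (z - 1)" by linarith
  then have z1: "z \<noteq> 1" by auto
  have "exp_sum p J (\<lambda>_. 1) (int y) = (\<Sum>j<N. ep p ((N0 + 1) * int y) * z ^ j)"
    unfolding eq z_def by (intro sum.cong refl) (simp add: ep_power[symmetric] ep_add[symmetric] algebra_simps)
  also have "\<dots> = ep p ((N0 + 1) * int y) * ((z ^ N - 1) / (z - 1))"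
    by (simp add: sum_distrib_left[symmetric] geometric_sum[OF z1])
  finally have "cmod (exp_sum p J (\<lambda>_. 1) (int y)) = cmod (z ^ N - 1) / cmod (z - 1)"
    by (simp add: norm_mult norm_divide)
  also have "\<dots> \<le> 2 / cmod (z - 1)"
  proof (rule divide_right_mono)
    have "cmod (z ^ N - 1) \<le> cmod (z ^ N) + cmod 1" by (rule norm_triangle_ineq4)
    then show "cmod (z ^ N - 1) \<le> 2" by (simp add: z_def norm_power)
  qed simp
  also have "\<dots> \<le> 2 / (2 * real y / real p)"
    using ge y p z1 by (intro divide_left_mono mult_pos_pos) auto
  also have "\<dots> = real p / real y" by simp
  finally show "cmod (exp_sum p J (\<lambda>_. 1) (int y)) \<le> real p / real y" .
qed

section \<open>Opening the Kloosterman sums\<close>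

lemma kloosterman_altdef:
  assumes p: "prime p" "p > 2"
  shows "kloosterman p m n = (\<Sum>x\<in>Fp_star p. ep p (m * x + n * x ^ (p - 2)))"
  unfolding kloosterman_def e_p_of_int
proof (rule sum.cong[OF refl])
  fix x assume x: "x \<in> Fp_star p"
  have nd: "\<not> int p dvd x" using x by (auto simp: Fp_star_def Fp_def dest: zdvd_imp_le)
  then have "coprime x (int p)"
    using p(1) by (metis coprime_commute prime_imp_coprime prime_nat_int_transfer)
  then have i: "[x * modular_inverse (int p) x = 1] (mod int p)" by (rule cong_modular_inverse1)
  have "[modular_inverse (int p) x * 1 = modular_inverse (int p) x * (x * x ^ (p - 2))] (mod int p)"
    by (intro cong_mult cong_refl cong_sym[OF prime_fermat_inverse[OF p nd]])
  also have "modular_inverse (int p) x * (x * x ^ (p - 2)) = (x * modular_inverse (int p) x) * x ^ (p - 2)"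
    by (simp only: mult_ac)
  also have "[\<dots> = 1 * x ^ (p - 2)] (mod int p)"
    by (intro cong_mult cong_refl i)
  finally have "[modular_inverse (int p) x = x ^ (p - 2)] (mod int p)" by simp
  then show "ep p (m * x + n * modular_inverse (int p) x) = ep p (m * x + n * x ^ (p - 2))"
    using p by (intro ep_cong cong_add cong_mult cong_refl) auto
qed

text \<open>Inversion is an involution on the nonzero residues, hence its own inverse map.\<close>

lemma bij_betw_fermat_inverse:
  assumes p: "prime p" "p > 2"
  shows "bij_betw (\<lambda>x. x ^ (p - 2) mod int p) (Fp_star p) (Fp_star p)"
    and "x \<in> Fp_star p \<Longrightarrow> [(x ^ (p - 2) mod int p) ^ (p - 2) = x] (mod int p)"
proof -
  define \<iota> where "\<iota> x = x ^ (p - 2) mod int p" for x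
  have nd: "\<not> int p dvd x" if "x \<in> Fp_star p" for x
    using that by (auto simp: Fp_star_def Fp_def dest: zdvd_imp_le)
  have inv: "[x * \<iota> x = 1] (mod int p)" if "x \<in> Fp_star p" for x
    using prime_fermat_inverse[OF p nd[OF that]] by (simp add: \<iota>_def cong_def mod_mult_right_eq)
  have mem: "\<iota> x \<in> Fp_star p" if "x \<in> Fp_star p" for x
  proof -
    have "\<iota> x \<noteq> 0"
    proof
      assume "\<iota> x = 0"
      then have "[0 = 1] (mod int p)" using inv[OF that] by simp
      then show False using p by (simp add: cong_def)
    qed
    then show ?thesis using p by (simp add: Fp_star_def Fp_def \<iota>_def)
  qed
  have invol: "[\<iota> (\<iota> x) = x] (mod int p)" if x: "x \<in> Fp_star p" for x
  proof -
    have "[1 * \<iota> (\<iota> x) = (x * \<iota> x) * \<iota> (\<iota> x)] (mod int p)"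
      by (intro cong_mult cong_refl cong_sym[OF inv[OF x]])
    also have "(x * \<iota> x) * \<iota> (\<iota> x) = x * (\<iota> x * \<iota> (\<iota> x))" by (simp only: mult_ac)
    also have "[\<dots> = x * 1] (mod int p)"
      by (intro cong_mult cong_refl inv mem x)
    finally show ?thesis by simp
  qed
  have "\<iota> (\<iota> x) = x" if "x \<in> Fp_star p" for x
    using invol[OF that] mem[OF mem[OF that]] that by (simp add: Fp_star_def Fp_def cong_def)
  then have "bij_betw \<iota> (Fp_star p) (Fp_star p)"
    using mem by (intro bij_betw_byWitness[where f' = \<iota>]) auto
  then show "bij_betw (\<lambda>x. x ^ (p - 2) mod int p) (Fp_star p) (Fp_star p)"
    by (simp add: \<iota>_def[abs_def])
  show "[(x ^ (p - 2) mod int p) ^ (p - 2) = x] (mod int p)" if "x \<in> Fp_star p"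
    using invol[OF that] by (simp add: \<iota>_def cong_def)
qed

text \<open>After opening, the variables \<open>m\<close> and \<open>n\<close> separate. The
  substitution of the inverse for \<open>x\<close> then puts the interval sum at \<open>y\<close>
  itself, where its bound decays with \<open>y\<close>, and moves the reciprocal to the weighted
  sum.\<close>

lemma bilinear_kloosterman_eq:
  assumes p: "prime p" "p > 2"
  shows "(\<Sum>m\<in>S. \<Sum>n\<in>J. \<alpha> m * kloosterman p m n) =
    (\<Sum>y\<in>Fp_star p. exp_sum p S \<alpha> (y ^ (p - 2)) * exp_sum p J (\<lambda>_. 1) y)"
proof -
  have p0: "p > 0" using p by simp
  have "(\<Sum>m\<in>S. \<Sum>n\<in>J. \<alpha> m * kloosterman p m n) =
      (\<Sum>m\<in>S. \<Sum>n\<in>J. \<Sum>x\<in>Fp_star p. (\<alpha> m * ep p (m * x)) * (1 * ep p (n * x ^ (p - 2))))"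
    by (simp add: kloosterman_altdef[OF p] ep_add sum_distrib_left mult.assoc)
  also have "\<dots> = (\<Sum>x\<in>Fp_star p. \<Sum>m\<in>S. \<Sum>n\<in>J. (\<alpha> m * ep p (m * x)) * (1 * ep p (n * x ^ (p - 2))))"
    by (subst (2) sum.swap, subst sum.swap) (rule refl)
  also have "\<dots> = (\<Sum>x\<in>Fp_star p. exp_sum p S \<alpha> x * exp_sum p J (\<lambda>_. 1) (x ^ (p - 2)))"
    by (simp only: exp_sum_def sum_product)
  also have "\<dots> = (\<Sum>y\<in>Fp_star p. exp_sum p S \<alpha> (y ^ (p - 2) mod int p) *
      exp_sum p J (\<lambda>_. 1) ((y ^ (p - 2) mod int p) ^ (p - 2)))"
    by (rule sum.reindex_bij_betw[OF bij_betw_fermat_inverse(1)[OF p], symmetric])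
  also have "\<dots> = (\<Sum>y\<in>Fp_star p. exp_sum p S \<alpha> (y ^ (p - 2)) * exp_sum p J (\<lambda>_. 1) y)"
    by (intro sum.cong refl arg_cong2[where f = "(*)"] exp_sum_cong p0 bij_betw_fermat_inverse(2)[OF p])
       (simp_all add: cong_def)
  finally show ?thesis .
qed

lemma sum_Fp_star_split:
  fixes f :: "int \<Rightarrow> real"
  assumes "p = 2 * h + 1"
  shows "(\<Sum>y\<in>Fp_star p. f y) = (\<Sum>y\<in>{1..h}. f (int y) + f (int p - int y))"
proof -
  have "Fp_star p = {1..int h} \<union> {int h + 1..2 * int h}"
    using assms by (auto simp: Fp_star_def Fp_def)
  then have "(\<Sum>y\<in>Fp_star p. f y) = (\<Sum>y\<in>{1..int h}. f y) + (\<Sum>y\<in>{int h + 1..2 * int h}. f y)"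
    by (simp only: sum.union_disjoint) (subst sum.union_disjoint, auto)
  also have "(\<Sum>y\<in>{1..int h}. f y) = (\<Sum>y\<in>{1..h}. f (int y))"
    by (rule sum.reindex_bij_witness[of _ int nat]) auto
  also have "(\<Sum>y\<in>{int h + 1..2 * int h}. f y) = (\<Sum>y\<in>{1..h}. f (int p - int y))"
    by (rule sum.reindex_bij_witness[of _ "\<lambda>y. int p - int y" "\<lambda>y. nat (int p - y)"]) (use assms in auto)
  finally show ?thesis by (simp add: sum.distrib)
qed

text \<open>The residues \<open>y\<close> and \<open>p - y\<close> are folded together so that only
  \<open>2 * y \<le> p\<close> occurs. Passing to \<open>- y\<close> conjugates both exponential
  sums, which replaces the weights by their conjugates and keeps the bound for the interval.\<close>

lemma norm_bilinear_kloosterman_le: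
  fixes S J :: "int set" and \<alpha> :: "int \<Rightarrow> complex"
  assumes p: "prime p" "p = 2 * h + 1" "1 \<le> h" and J: "Fp_interval p N J" "J \<subseteq> Fp_star p"
  defines "G \<equiv> \<lambda>\<beta> y. cmod (exp_sum p S \<beta> (int y ^ (p - 2)))"
  shows "cmod (\<Sum>m\<in>S. \<Sum>n\<in>J. \<alpha> m * kloosterman p m n) \<le>
    (\<Sum>y\<in>{1..h}. min (real N) (real p / real y) * (G \<alpha> y + G (\<lambda>m. cnj (\<alpha> m)) y))"
proof -
  define F where "F = exp_sum p J (\<lambda>_. 1)"
  have p2: "p > 2" "p > 0" using p by auto
  have "cmod (\<Sum>m\<in>S. \<Sum>n\<in>J. \<alpha> m * kloosterman p m n) \<le>
      (\<Sum>y\<in>Fp_star p. cmod (exp_sum p S \<alpha> (y ^ (p - 2))) * cmod (F y))"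
    unfolding bilinear_kloosterman_eq[OF p(1) p2(1)] F_def
    by (rule order_trans[OF norm_sum]) (simp add: norm_mult)
  also have "\<dots> = (\<Sum>y\<in>{1..h}. cmod (exp_sum p S \<alpha> (int y ^ (p - 2))) * cmod (F (int y)) +
      cmod (exp_sum p S \<alpha> ((int p - int y) ^ (p - 2))) * cmod (F (int p - int y)))"
    by (rule sum_Fp_star_split[OF p(2)])
  also have "\<dots> \<le> (\<Sum>y\<in>{1..h}. min (real N) (real p / real y) * (G \<alpha> y + G (\<lambda>m. cnj (\<alpha> m)) y))"
  proof (rule sum_mono)
    fix y assume y: "y \<in> {1..h}"
    have c: "[int p - int y = - int y] (mod int p)" by (simp add: cong_iff_dvd_diff)
    \<comment> \<open>Oddness makes the reciprocal of \<open>- y\<close> the negative of the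
      reciprocal of \<open>y\<close>.\<close>
    have "odd (p - 2)" using p by simp
    then have "(- int y) ^ (p - 2) = - (int y ^ (p - 2))" by (rule power_minus_odd)
    then have "[(int p - int y) ^ (p - 2) = - (int y ^ (p - 2))] (mod int p)"
      using cong_pow[OF c, of "p - 2"] by simp
    then have "exp_sum p S \<alpha> ((int p - int y) ^ (p - 2)) = exp_sum p S \<alpha> (- (int y ^ (p - 2)))"
      by (rule exp_sum_cong[OF p2(2)])
    then have A: "cmod (exp_sum p S \<alpha> ((int p - int y) ^ (p - 2))) = G (\<lambda>m. cnj (\<alpha> m)) y"
      by (simp add: exp_sum_minus G_def)
    have "F (int p - int y) = F (- int y)" unfolding F_def by (rule exp_sum_cong[OF p2(2) c])
    then have F: "cmod (F (int p - int y)) = cmod (F (int y))"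
      by (simp add: F_def exp_sum_minus)
    have "cmod (F (int y)) \<le> min (real N) (real p / real y)"
      using exp_sum_interval_bounds[OF p2(2) J] y p(2) by (simp add: F_def)
    then have "(G \<alpha> y + G (\<lambda>m. cnj (\<alpha> m)) y) * cmod (F (int y)) \<le>
        (G \<alpha> y + G (\<lambda>m. cnj (\<alpha> m)) y) * min (real N) (real p / real y)"
      by (intro mult_left_mono) (auto simp: G_def)
    then show "cmod (exp_sum p S \<alpha> (int y ^ (p - 2))) * cmod (F (int y)) +
        cmod (exp_sum p S \<alpha> ((int p - int y) ^ (p - 2))) * cmod (F (int p - int y)) \<le>
        min (real N) (real p / real y) * (G \<alpha> y + G (\<lambda>m. cnj (\<alpha> m)) y)"
      unfolding A F by (simp add: G_def algebra_simps)
  qed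
  finally show ?thesis .
qed

theorem corollary2p9:
  shows "\<forall>\<epsilon>::real. \<epsilon> > 0 \<longrightarrow>
    (\<exists>(\<delta>::real) (\<eta>::real) (C::real) (p0::nat). \<delta> > 0 \<and> \<eta> > 0 \<and> C > 0 \<and>
      (\<forall>(p::nat) (S::int set) (J::int set) (N::nat) (\<alpha>::int \<Rightarrow> complex).
        prime p \<longrightarrow> p \<ge> p0 \<longrightarrow>
        S \<subseteq> Fp p \<longrightarrow> real (card S) > real p powr \<epsilon> \<longrightarrow>
        Fp_interval p N J \<longrightarrow> J \<subseteq> Fp_star p \<longrightarrow> real N > real p powr (1/2 - \<delta>) \<longrightarrow>
        cmod (\<Sum>m\<in>S. \<Sum>n\<in>J. \<alpha> m * kloosterman p m n)
          \<le> C * weight_sup_norm S \<alpha> * real (card S) * real N * real p powr (1/2 - \<eta>)))"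
proof (intro allI impI)
  fix \<epsilon> :: real assume "\<epsilon> > 0"
  \<comment> \<open>The power saving was proved for exponents up to 1; a larger
    \<open>\<epsilon>\<close> only strengthens the assumption on \<open>S\<close>.\<close>
  then have "0 < min \<epsilon> 1" "min \<epsilon> 1 \<le> 1" by auto
  then obtain \<kappa> C :: real where \<kappa>: "\<kappa> > 0" and C: "C > 0" and bound:
    "\<And>p S \<alpha> A Y. prime p \<Longrightarrow> p \<ge> 5 \<Longrightarrow> S \<subseteq> {0..<int p} \<Longrightarrow> real (card S) > real p powr min \<epsilon> 1 \<Longrightarrow>
       (\<And>m. m \<in> S \<Longrightarrow> cmod (\<alpha> m) \<le> A) \<Longrightarrow> real Y \<ge> sqrt (real p) \<Longrightarrow>
       (\<Sum>y\<in>{1..Y}. cmod (exp_sum p S \<alpha> (int y ^ (p - 2)))) \<le>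
         C * A * real (card S) * real Y * real p powr (- \<kappa>)"
    using exp_sum_reciprocals_power_saving by blast
  \<comment> \<open>The factor 2 accounts for \<open>\<alpha>\<close> and its conjugate;
    \<open>3 + 4 / \<kappa>\<close> is 2 from the boundary term plus \<open>1 + 4 / \<kappa>\<close>
    from the harmonic sum.\<close>
  define C' where "C' = 2 * C * (3 + 4 / \<kappa>)"
  have main: "cmod (\<Sum>m\<in>S. \<Sum>n\<in>J. \<alpha> m * kloosterman p m n)
      \<le> C' * weight_sup_norm S \<alpha> * real (card S) * real N * real p powr (1/2 - \<kappa> / 2)"
    if p: "prime p" "p \<ge> 5" and S: "S \<subseteq> Fp p" "real (card S) > real p powr \<epsilon>"
      and J: "Fp_interval p N J" "J \<subseteq> Fp_star p" and N: "real N > real p powr (1/2 - \<kappa> / 4)"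
    for p S J N \<alpha>
  proof -
    define P where "P = real p"
    define A where "A = weight_sup_norm S \<alpha>"
    define M where "M = real (card S)"
    define c where "c = C * A * M * P powr (- \<kappa>)"
    have P: "P \<ge> 5" using p by (simp add: P_def)
    have finS: "finite S" using S(1) finite_subset by (auto simp: Fp_def)
    have "real p powr min \<epsilon> 1 \<le> real p powr \<epsilon>" using p by (intro powr_mono) auto
    then have M: "M > P powr min \<epsilon> 1" using S(2) by (simp add: M_def P_def)
    then have M0: "M > 0" by (rule le_less_trans[rotated]) simp
    have \<alpha>: "cmod (\<alpha> m) \<le> A" if "m \<in> S" for m
      unfolding A_def weight_sup_norm_def using finS that by (intro Max_ge) auto
    have "S \<noteq> {}" using M0 by (auto simp: M_def)
    then have A0: "A \<ge> 0" using \<alpha> norm_ge_zero order_trans by (metis all_not_in_conv)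
    have c0: "c \<ge> 0" unfolding c_def using C A0 M0 by simp
    have "odd p" using p prime_odd_nat by auto
    then obtain h where h: "p = 2 * h + 1" by (rule oddE)
    have h1: "1 \<le> h" using h p by simp
    define G where "G \<beta> y = cmod (exp_sum p S \<beta> (int y ^ (p - 2)))" for \<beta> y
    have large: "(\<Sum>y\<in>{1..Y}. G \<beta> y) \<le> c * real Y"
      if "\<And>m. m \<in> S \<Longrightarrow> cmod (\<beta> m) \<le> A" "real Y \<ge> sqrt P" for \<beta> Y
      using bound[where S = S and \<alpha> = \<beta> and A = A and Y = Y, OF p _ _ that(1)] S M that(2)
      by (simp add: G_def c_def M_def P_def Fp_def mult_ac)
    \<comment> \<open>Partial summation needs a bound for every \<open>Y\<close>. Below the square
      root of \<open>P\<close> the sum of nonnegative terms is extended to the ceiling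
      \<open>Y'\<close> of that root, which is at most twice the root.\<close>
    have T: "(\<Sum>y\<in>{1..Y}. G \<beta> y) \<le> c * (2 * sqrt P + real Y)"
      if \<beta>: "\<And>m. m \<in> S \<Longrightarrow> cmod (\<beta> m) \<le> A" for \<beta> Y
    proof (cases "real Y \<ge> sqrt P")
      case True
      have "c * real Y \<le> c * (2 * sqrt P + real Y)" using c0 P by (intro mult_left_mono) auto
      then show ?thesis using large[of \<beta> Y, OF \<beta> True] by linarith
    next
      case False
      define Y' where "Y' = nat \<lceil>sqrt P\<rceil>"
      have Y': "real Y' \<ge> sqrt P" unfolding Y'_def by (rule real_nat_ceiling_ge)
      have "1 \<le> sqrt P" using P by simp
      then have "real Y' \<le> 2 * sqrt P + real Y" unfolding Y'_def by linarith
      moreover have "Y \<le> Y'" using False Y' by linarith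
      then have "(\<Sum>y\<in>{1..Y}. G \<beta> y) \<le> (\<Sum>y\<in>{1..Y'}. G \<beta> y)"
        by (intro sum_mono2) (auto simp: G_def)
      moreover have "(\<Sum>y\<in>{1..Y'}. G \<beta> y) \<le> c * real Y'" by (rule large[of \<beta> Y', OF \<beta> Y'])
      ultimately show ?thesis using c0 by (meson mult_left_mono order_trans)
    qed
    define g where "g y = min (real N) (P / real y)" for y
    have g_dec: "g (Suc y) \<le> g y" if "1 \<le> y" for y
    proof -
      have "P / real (Suc y) \<le> P / real y" using that P by (intro divide_left_mono) auto
      then show ?thesis unfolding g_def by linarith
    qed
    have abel: "(\<Sum>y\<in>{1..h}. g y * G \<beta> y) \<le> c * (2 * sqrt P * g 1 + (\<Sum>y\<in>{1..h}. g y))"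
      if "\<And>m. m \<in> S \<Longrightarrow> cmod (\<beta> m) \<le> A" for \<beta>
    proof (rule abel_sum_le[where g = g and h = h and G = "G \<beta>" and c = c and r = "2 * sqrt P"])
      show "g (Suc y) \<le> g y" if "1 \<le> y" for y using that by (rule g_dec)
      show "1 \<le> h" by (rule h1)
      show "(\<Sum>y\<in>{1..Y}. G \<beta> y) \<le> c * (2 * sqrt P + real Y)" for Y
        by (rule T) (rule that)
      show "0 \<le> g h" using P by (simp add: g_def)
    qed
    have "(\<Sum>y\<in>{1..h}. g y) \<le> (\<Sum>y\<in>{1..h}. P * inverse (real y))"
      by (intro sum_mono) (simp add: g_def divide_inverse)
    also have "\<dots> = P * harm h" by (simp add: harm_def sum_distrib_left)
    also have "\<dots> \<le> P * harm p" using P h by (intro mult_left_mono harm_mono) auto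
    \<comment> \<open>Budget of exponents: the harmonic number loses \<open>\<kappa> / 4\<close>,
      and the short interval, through \<open>N > P powr (1 / 2 - \<kappa> / 4)\<close>, loses
      another \<open>\<kappa> / 4\<close>. Against the saving of \<open>\<kappa>\<close> in
      \<open>c\<close> this leaves \<open>\<kappa> / 2\<close>.\<close>
    also have "\<dots> \<le> P * ((1 + 1 / (\<kappa> / 4)) * P powr (\<kappa> / 4))"
      unfolding P_def using p \<kappa> by (intro mult_left_mono harm_le_powr) auto
    also have "\<dots> \<le> real N * P powr (1 / 2 + \<kappa> / 4) * ((1 + 1 / (\<kappa> / 4)) * P powr (\<kappa> / 4))"
    proof (rule mult_right_mono)
      have "P = P powr (1 / 2 - \<kappa> / 4) * P powr (1 / 2 + \<kappa> / 4)"
        using P by (simp add: powr_add[symmetric])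
      also have "\<dots> \<le> real N * P powr (1 / 2 + \<kappa> / 4)"
        using N by (intro mult_right_mono) (auto simp: P_def)
      finally show "P \<le> real N * P powr (1 / 2 + \<kappa> / 4)" .
    qed (use \<kappa> in simp)
    also have "\<dots> = (1 + 4 / \<kappa>) * real N * (P powr (1 / 2 + \<kappa> / 4) * P powr (\<kappa> / 4))"
      by simp
    also have "P powr (1 / 2 + \<kappa> / 4) * P powr (\<kappa> / 4) = P powr (1 / 2 + \<kappa> / 2)"
    proof -
      have "1 / 2 + \<kappa> / 2 = 1 / 2 + \<kappa> / 4 + \<kappa> / 4" by simp
      then show ?thesis by (simp only: powr_add)
    qed
    finally have sg: "(\<Sum>y\<in>{1..h}. g y) \<le> (1 + 4 / \<kappa>) * real N * P powr (1 / 2 + \<kappa> / 2)" .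
    have "2 * sqrt P * g 1 \<le> 2 * P powr (1 / 2 + \<kappa> / 2) * real N"
    proof (rule mult_mono)
      have "P powr (1 / 2) \<le> P powr (1 / 2 + \<kappa> / 2)" using P \<kappa> by (intro powr_mono) auto
      then show "2 * sqrt P \<le> 2 * P powr (1 / 2 + \<kappa> / 2)" using P by (simp add: powr_half_sqrt)
    qed (use P in \<open>auto simp: g_def\<close>)
    with sg have tot: "2 * sqrt P * g 1 + (\<Sum>y\<in>{1..h}. g y) \<le>
        (3 + 4 / \<kappa>) * real N * P powr (1 / 2 + \<kappa> / 2)"
      by (simp add: algebra_simps)
    have "cmod (\<Sum>m\<in>S. \<Sum>n\<in>J. \<alpha> m * kloosterman p m n) \<le>
        (\<Sum>y\<in>{1..h}. g y * (G \<alpha> y + G (\<lambda>m. cnj (\<alpha> m)) y))"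
      unfolding g_def G_def P_def by (rule norm_bilinear_kloosterman_le[OF p(1) h h1 J])
    also have "\<dots> = (\<Sum>y\<in>{1..h}. g y * G \<alpha> y) + (\<Sum>y\<in>{1..h}. g y * G (\<lambda>m. cnj (\<alpha> m)) y)"
      by (simp add: distrib_left sum.distrib)
    also have "\<dots> \<le> 2 * (c * (2 * sqrt P * g 1 + (\<Sum>y\<in>{1..h}. g y)))"
      using abel[of \<alpha>] abel[of "\<lambda>m. cnj (\<alpha> m)"] \<alpha> by simp
    also have "\<dots> \<le> 2 * (c * ((3 + 4 / \<kappa>) * real N * P powr (1 / 2 + \<kappa> / 2)))"
      using tot c0 by (intro mult_left_mono) auto
    also have "\<dots> = C' * A * M * real N * (P powr (- \<kappa>) * P powr (1 / 2 + \<kappa> / 2))"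
      by (simp add: c_def C'_def mult_ac)
    also have "P powr (- \<kappa>) * P powr (1 / 2 + \<kappa> / 2) = P powr (1 / 2 - \<kappa> / 2)"
    proof -
      have "1 / 2 - \<kappa> / 2 = - \<kappa> + (1 / 2 + \<kappa> / 2)" by simp
      then show ?thesis by (simp only: powr_add)
    qed
    finally show ?thesis by (simp only: A_def M_def P_def)
  qed
  have "C' > 0" using C \<kappa> by (simp add: C'_def add_pos_pos)
  then show "\<exists>(\<delta>::real) (\<eta>::real) (C::real) (p0::nat). \<delta> > 0 \<and> \<eta> > 0 \<and> C > 0 \<and>
      (\<forall>(p::nat) (S::int set) (J::int set) (N::nat) (\<alpha>::int \<Rightarrow> complex).
        prime p \<longrightarrow> p \<ge> p0 \<longrightarrow>
        S \<subseteq> Fp p \<longrightarrow> real (card S) > real p powr \<epsilon> \<longrightarrow>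
        Fp_interval p N J \<longrightarrow> J \<subseteq> Fp_star p \<longrightarrow> real N > real p powr (1/2 - \<delta>) \<longrightarrow>
        cmod (\<Sum>m\<in>S. \<Sum>n\<in>J. \<alpha> m * kloosterman p m n)
          \<le> C * weight_sup_norm S \<alpha> * real (card S) * real N * real p powr (1/2 - \<eta>))"
    using main \<kappa> by (intro exI[of _ "\<kappa> / 4"] exI[of _ "\<kappa> / 2"] exI[of _ C'] exI[of _ 5]) auto
qed

end
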